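(* Let $G=(V,E)$, the weights, $F$ and $k$ be as in the model. For each vertex $v\in V$, let $d_v=d(v,F)$ and fix a point $f(v)\in F$ with $d(v,f(v))=d_v$. Let $$\Gamma(v)=\{p\in G: p\neq f(v),\ d(v,p)=d_v\},\qquad \Gamma_0=\bigcup_{v\in V}\Gamma(v).$$ For $\varepsilon>0$, let $N_\varepsilon=\{p\in G: d(p,F)=\varepsilon\}$ (the points at distance exactly $\varepsilon$ from P1's facilities), and let $C_\varepsilon=(\Gamma_0\cup V\cup N_\varepsilon)\setminus F$. Then $$\eta(F)=\sup_{\varepsilon>0}\ \max\{\mathcal Q_2(F,S): S\subseteq C_\varepsilon,\ |S|\le k\}.$$ That is, placements of P2 using only points of $\Gamma_0\cup V$ together with points arbitrarily close to P1's facilities achieve the optimal payoff of P2.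
   Context: Model. $G=(V,E)$ is a finite connected graph with at least one edge. Each vertex $v$ has a weight $w(v)\ge 0$ and each edge $e$ has a length $w(e)>0$. $G$ is regarded as a metric space by identifying each edge $e=(u,v)$ with a segment of length $w(e)$ joining $u$ and $v$. A point of $G$ is a vertex or a point of an edge. $d(p,q)$ denotes the length of a shortest path in $G$ between points $p$ and $q$. For a finite nonempty set $A$ of points, $d(p,A)=\min_{a\in A}d(p,a)$. Player P1 places a set $F$ of $m\ge 1$ points of $G$. Afterwards Player P2 places a set $S$ of $k$ points of $G$ with $S\cap F=\emptyset$. A point $p$ is served by P2 if $d(p,S)\le d(p,F)$ (ties go to P2), and by P1 otherwise. The payoff of P2 is $$\mathcal Q_2(F,S)=\sum_{v\in V:\ d(v,S)\le d(v,F)} w(v)\;+\;\lambda\big(\{p \text{ in the interior of an edge}: d(p,S)\le d(p,F)\}\big),$$ where $\lambda$ is total length (one-dimensional Lebesgue measure along the edges). The payoff $\mathcal Q_2(F,S)$ is defined by the same formula for any finite set $S$ disjoint from $F$. The maximum payoff of P2 is $\eta(F)=\sup_S \mathcal Q_2(F,S)$, where the supremum ranges over all sets $S$ of $k$ points of $G$ disjoint from $F$. In the paper, the points of $N_\varepsilon$ for infinitesimal $\varepsilon$ are modelled as "points at distance effectively zero from a facility of P1". *)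

theory Defs
  imports "HOL-Analysis.Analysis"
begin

(* Metric graph.  Vertices have a linearly ordered type; an edge is stored once as
   an ordered pair (a,b) with a < b.  wl (a,b) > 0 is the edge length. *)

datatype 'v point = Vx 'v | Ed 'v 'v real
  (* Ed a b t : the point of edge (a,b) at distance t from a, 0 < t < wl (a,b) *)

definition adj :: "('v \<times> 'v) set \<Rightarrow> 'v \<Rightarrow> 'v \<Rightarrow> bool" where
  "adj E a b \<longleftrightarrow> (a, b) \<in> E \<or> (b, a) \<in> E"

definition elen :: "('v \<times> 'v) set \<Rightarrow> ('v \<times> 'v \<Rightarrow> real) \<Rightarrow> 'v \<Rightarrow> 'v \<Rightarrow> real" where
  "elen E wl a b = (if (a, b) \<in> E then wl (a, b) else wl (b, a))"

definition is_walk :: "('v \<times> 'v) set \<Rightarrow> 'v \<Rightarrow> 'v \<Rightarrow> 'v list \<Rightarrow> bool" where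
  "is_walk E u v xs \<longleftrightarrow> xs \<noteq> [] \<and> hd xs = u \<and> last xs = v \<and>
     (\<forall>i. Suc i < length xs \<longrightarrow> adj E (xs ! i) (xs ! Suc i))"

definition walk_len :: "('v \<times> 'v) set \<Rightarrow> ('v \<times> 'v \<Rightarrow> real) \<Rightarrow> 'v list \<Rightarrow> real" where
  "walk_len E wl xs = sum_list (map (\<lambda>(a, b). elen E wl a b) (zip xs (tl xs)))"

definition vdist :: "('v \<times> 'v) set \<Rightarrow> ('v \<times> 'v \<Rightarrow> real) \<Rightarrow> 'v \<Rightarrow> 'v \<Rightarrow> real" where
  "vdist E wl u v = Inf {walk_len E wl xs | xs. is_walk E u v xs}"

definition Pts :: "'v set \<Rightarrow> ('v \<times> 'v) set \<Rightarrow> ('v \<times> 'v \<Rightarrow> real) \<Rightarrow> 'v point set" where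
  "Pts V E wl = Vx ` V \<union> {Ed a b t | a b t. (a, b) \<in> E \<and> 0 < t \<and> t < wl (a, b)}"

fun anch :: "('v \<times> 'v \<Rightarrow> real) \<Rightarrow> 'v point \<Rightarrow> ('v \<times> real) set" where
  "anch wl (Vx v) = {(v, 0)}"
| "anch wl (Ed a b t) = {(a, t), (b, wl (a, b) - t)}"

fun pdist :: "('v \<times> 'v) set \<Rightarrow> ('v \<times> 'v \<Rightarrow> real) \<Rightarrow> 'v point \<Rightarrow> 'v point \<Rightarrow> real" where
  "pdist E wl (Ed a b t) (Ed a' b' t') =
     (let base = Min {s + vdist E wl x y + r | x s y r. (x, s) \<in> anch wl (Ed a b t) \<and> (y, r) \<in> anch wl (Ed a' b' t')}
      in if a = a' \<and> b = b' then min base \<bar>t - t'\<bar> else base)"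
| "pdist E wl p q = Min {s + vdist E wl x y + r | x s y r. (x, s) \<in> anch wl p \<and> (y, r) \<in> anch wl q}"

(* d(p, A) for finite nonempty A *)
definition dist_to_set :: "('v \<times> 'v) set \<Rightarrow> ('v \<times> 'v \<Rightarrow> real) \<Rightarrow> 'v point \<Rightarrow> 'v point set \<Rightarrow> real" where
  "dist_to_set E wl p A = Min (pdist E wl p ` A)"

(* p is served by P2: d(p,S) <= d(p,F)  (false for S = {}) *)
definition served :: "('v \<times> 'v) set \<Rightarrow> ('v \<times> 'v \<Rightarrow> real) \<Rightarrow> 'v point set \<Rightarrow> 'v point set \<Rightarrow> 'v point \<Rightarrow> bool" where
  "served E wl F S p \<longleftrightarrow> (\<exists>s\<in>S. pdist E wl p s \<le> dist_to_set E wl p F)"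

definition Q2 :: "'v set \<Rightarrow> ('v \<times> 'v) set \<Rightarrow> ('v \<Rightarrow> real) \<Rightarrow> ('v \<times> 'v \<Rightarrow> real)
                  \<Rightarrow> 'v point set \<Rightarrow> 'v point set \<Rightarrow> real" where
  "Q2 V E wv wl F S =
     (\<Sum>v\<in>V. if served E wl F S (Vx v) then wv v else 0)
   + (\<Sum>e\<in>E. measure lborel {t \<in> {0<..<wl e}. served E wl F S (Ed (fst e) (snd e) t)})"

definition eta :: "'v set \<Rightarrow> ('v \<times> 'v) set \<Rightarrow> ('v \<Rightarrow> real) \<Rightarrow> ('v \<times> 'v \<Rightarrow> real)
                  \<Rightarrow> nat \<Rightarrow> 'v point set \<Rightarrow> real" where
  "eta V E wv wl k F = Sup {Q2 V E wv wl F S | S. S \<subseteq> Pts V E wl \<and> finite S \<and> card S = k \<and> S \<inter> F = {}}"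

end

theory Submission
  imports Defs
begin

text \<open>
  Fix \<open>S\<close> disjoint from \<open>F\<close> and \<open>\<epsilon> \<le> d(p, F)\<close> for all \<open>p \<in> S\<close>. A point \<open>p \<in> S\<close> that is not a candidate
  lies inside an edge; slide it between the two neighbouring candidate points (or end points) of
  that edge. No level set \<open>d(\<cdot>, F) = \<epsilon>\<close> is crossed, so both ends stay outside \<open>F\<close>, and no
  point of \<open>\<Gamma>\<close> is crossed, so no vertex changes sides. Cut every edge at the points of \<open>F\<close>. On each
  piece the length served, as a function of the coordinate \<open>x\<close> of the sliding point, has a subgradient
  at its present value \<open>x\<^sub>0\<close>, because the distance of a fixed point to the sliding one is
  a minimum of two affine functions of \<open>x\<close>. Summing, the payoff is at least
  \<open>Q\<^sub>2(F, S) + \<sigma> (x - x\<^sub>0)\<close>, so sliding towards one of the two ends loses nothing. Repeating this for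
  every \<open>p\<close> puts \<open>S\<close> into \<open>C\<^sub>\<epsilon>\<close>.
\<close>

section \<open>Served length of a segment\<close>

text \<open>
  The segment \<open>[c, d]\<close> is a piece of an edge without facilities of P1 inside; \<open>hl\<close>, \<open>hr\<close> are the
  distances of its ends to \<open>F\<close>, and \<open>gc s\<close>, \<open>gd s\<close> those to the server \<open>s\<close>. The servers
  lying on the segment are those with \<open>on s\<close>, at coordinate \<open>y s\<close>.
\<close>

definition seg_region ::
  "real \<Rightarrow> real \<Rightarrow> real \<Rightarrow> real \<Rightarrow> 's set \<Rightarrow> ('s \<Rightarrow> real) \<Rightarrow> ('s \<Rightarrow> real) \<Rightarrow> ('s \<Rightarrow> bool) \<Rightarrow> ('s \<Rightarrow> real) \<Rightarrow> real set"
  where "seg_region c d hl hr S gc gd on y = {t \<in> {c<..<d}. \<exists>s\<in>S.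
     min (gc s + (t - c)) (gd s + (d - t)) \<le> min (hl + (t - c)) (hr + (d - t))
     \<or> on s \<and> \<bar>t - y s\<bar> \<le> min (hl + (t - c)) (hr + (d - t))}"

text \<open>A minimum lies below a bound exactly when one of its terms does, and terms measured from
  the same end share their dependence on \<open>t\<close>. This isolates the conditions
  \<open>gc s \<le> hl\<close> and \<open>gd s \<le> hr\<close> on the ends alone, which govern the
  later case splits.\<close>

lemma seg_region_iff:
  "t \<in> seg_region c d hl hr S gc gd on y \<longleftrightarrow> c < t \<and> t < d \<and> (\<exists>s\<in>S.
      gc s \<le> hl \<and> gc s + (t - c) \<le> hr + (d - t)
      \<or> gd s \<le> hr \<and> gd s + (d - t) \<le> hl + (t - c)
      \<or> on s \<and> \<bar>t - y s\<bar> \<le> hl + (t - c) \<and> \<bar>t - y s\<bar> \<le> hr + (d - t))"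
proof -
  have "min (a + p) (b + q) \<le> min (a' + p) (b' + q)
      \<longleftrightarrow> a \<le> a' \<and> a + p \<le> b' + q \<or> b \<le> b' \<and> b + q \<le> a' + p" for a b a' b' p q :: real
    by (auto simp: min_le_iff_disj)
  then show ?thesis unfolding seg_region_def by (simp add: conj_assoc disj_assoc)
qed

text \<open>Reflecting the line exchanges the two ends, so the case where only the right end is
  served reduces to the one for the left end.\<close>

lemma seg_region_uminus:
  "seg_region (- d) (- c) hr hl S gd gc on (\<lambda>s. - y s) = uminus ` seg_region c d hl hr S gc gd on y"
proof -
  have "t \<in> seg_region (- d) (- c) hr hl S gd gc on (\<lambda>s. - y s)
    \<longleftrightarrow> - t \<in> seg_region c d hl hr S gc gd on y" for t
  proof -
    have 1: "\<bar>t - - y s\<bar> = \<bar>- t - y s\<bar>" for s by simp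
    have 2: "- c - t = - t - c" "t - - d = d - - t" by auto
    have 3: "- d < t \<longleftrightarrow> - t < d" "t < - c \<longleftrightarrow> c < - t" by auto
    show ?thesis unfolding seg_region_iff 1 2 3 by blast
  qed
  moreover have "t \<in> uminus ` A \<longleftrightarrow> - t \<in> A" for t :: real and A
    by (metis imageE imageI minus_minus)
  ultimately show ?thesis by blast
qed

lemma measure_lborel_uminus:
  fixes A :: "real set"
  assumes "A \<in> sets borel"
  shows "measure lborel (uminus ` A) = measure lborel A"
proof -
  have "uminus ` A = uminus -` A \<inter> space lborel" by (auto simp: image_iff) (metis minus_minus)
  then have "measure lborel (uminus ` A) = measure (distr lborel borel uminus) A"
    using assms by (simp add: measure_distr)
  then show ?thesis by (simp add: lborel_distr_uminus)
qed

lemma seg_region_sets: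
  assumes "finite S"
  shows "seg_region c d hl hr S gc gd on y \<in> sets borel"
  unfolding seg_region_def using assms by measurable

lemma seg_region_subset: "seg_region c d hl hr S gc gd on y \<subseteq> {c<..<d}"
  by (auto simp: seg_region_def)

lemma measure_le_interval:
  fixes A :: "real set"
  assumes "A \<subseteq> {l..u}" "A \<in> sets borel" "l \<le> u"
  shows "measure lborel A \<le> u - l"
proof -
  have "{l..u} \<in> fmeasurable lborel"
    by (rule fmeasurableI) (use assms(3) in auto)
  then have "measure lborel A \<le> measure lborel {l..u}"
    by (intro measure_mono_fmeasurable) (use assms in auto)
  then show ?thesis using measure_lborel_Icc[OF assms(3)] by simp
qed

text \<open>The bounded frame \<open>{c<..<d}\<close> gives \<open>A\<close> finite measure, which
  monotonicity of \<open>measure\<close> requires. For \<open>u < l\<close> the left side is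
  negative, so callers need not check that the interval is nonempty.\<close>

lemma measure_ge_interval:
  fixes A :: "real set"
  assumes "{l<..<u} \<subseteq> A" "A \<in> sets borel" "A \<subseteq> {c<..<d}"
  shows "u - l \<le> measure lborel A"
proof (cases "l \<le> u")
  case True
  have "{c<..<d} \<in> fmeasurable lborel"
    by (cases "c \<le> d") (auto intro: fmeasurableI)
  then have "A \<in> fmeasurable lborel"
    by (rule fmeasurableI2) (use assms in auto)
  then have "measure lborel {l<..<u} \<le> measure lborel A"
    by (intro measure_mono_fmeasurable) (use assms in auto)
  then show ?thesis using measure_lborel_Ioo[OF True] by simp
next
  case False
  then show ?thesis using measure_nonneg[of lborel A] by linarith
qed

text \<open>
  The servers depend on the position \<open>x \<in> I\<close> of the sliding one. The last four assumptions say that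
  an end changes sides at most into a tie.
\<close>

locale segment_servers =
  fixes c d hl hr x0 :: real and I :: "real set" and S :: "'s set"
    and gc gd y :: "'s \<Rightarrow> real \<Rightarrow> real" and on :: "'s \<Rightarrow> bool"
  assumes cd: "c < d" and finS: "finite S" and x0: "x0 \<in> I"
    and h_nonneg: "hl \<ge> 0" "hr \<ge> 0" and h_lip: "\<bar>hl - hr\<bar> \<le> d - c"
    and g_lip: "\<And>s x. s \<in> S \<Longrightarrow> x \<in> I \<Longrightarrow> \<bar>gc s x - gd s x\<bar> \<le> d - c"
    and gc_sup: "\<And>s. s \<in> S \<Longrightarrow> \<exists>\<sigma>. \<forall>x\<in>I. gc s x \<le> gc s x0 + \<sigma> * (x - x0)"
    and gd_sup: "\<And>s. s \<in> S \<Longrightarrow> \<exists>\<sigma>. \<forall>x\<in>I. gd s x \<le> gd s x0 + \<sigma> * (x - x0)"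
    and y_aff: "\<And>s. s \<in> S \<Longrightarrow> on s \<Longrightarrow> \<exists>\<tau>. \<forall>x\<in>I. y s x = y s x0 + \<tau> * (x - x0)"
    and y_in: "\<And>s x. s \<in> S \<Longrightarrow> on s \<Longrightarrow> x \<in> I \<Longrightarrow> c \<le> y s x \<and> y s x \<le> d"
    and y_gc: "\<And>s x. s \<in> S \<Longrightarrow> on s \<Longrightarrow> x \<in> I \<Longrightarrow> gc s x \<le> y s x - c"
    and y_gd: "\<And>s x. s \<in> S \<Longrightarrow> on s \<Longrightarrow> x \<in> I \<Longrightarrow> gd s x \<le> d - y s x"
    and c_keep: "\<And>s x. s \<in> S \<Longrightarrow> x \<in> I \<Longrightarrow> gc s x0 \<le> hl \<Longrightarrow> gc s x \<le> hl"
    and c_keep': "\<And>s x. s \<in> S \<Longrightarrow> x \<in> I \<Longrightarrow> gc s x0 > hl \<Longrightarrow> gc s x \<ge> hl"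
    and d_keep: "\<And>s x. s \<in> S \<Longrightarrow> x \<in> I \<Longrightarrow> gd s x0 \<le> hr \<Longrightarrow> gd s x \<le> hr"
    and d_keep': "\<And>s x. s \<in> S \<Longrightarrow> x \<in> I \<Longrightarrow> gd s x0 > hr \<Longrightarrow> gd s x \<ge> hr"
begin

abbreviation R :: "real \<Rightarrow> real set" where
  "R x \<equiv> seg_region c d hl hr S (\<lambda>s. gc s x) (\<lambda>s. gd s x) on (\<lambda>s. y s x)"

lemma R_ge: "{l<..<u} \<subseteq> R x \<Longrightarrow> u - l \<le> measure lborel (R x)"
  by (rule measure_ge_interval[OF _ seg_region_sets[OF finS] seg_region_subset])

lemma R_le: "R x \<subseteq> {l..u} \<Longrightarrow> l \<le> u \<Longrightarrow> measure lborel (R x) \<le> u - l"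
  by (rule measure_le_interval[OF _ seg_region_sets[OF finS]])

lemma in_R_I:
  assumes "s \<in> S" "c < t" "t < d"
    and "gc s x \<le> hl \<and> gc s x + (t - c) \<le> hr + (d - t)
      \<or> gd s x \<le> hr \<and> gd s x + (d - t) \<le> hl + (t - c)
      \<or> on s \<and> \<bar>t - y s x\<bar> \<le> hl + (t - c) \<and> \<bar>t - y s x\<bar> \<le> hr + (d - t)"
  shows "t \<in> R x"
  using assms unfolding seg_region_iff by blast

text \<open>Facilities reach a point of the segment through one of its ends, and some server is no
  farther from that end. So the whole segment is served for every \<open>x\<close>.\<close>

lemma subgradient_both:
  assumes "s \<in> S" "gc s x0 \<le> hl" "s' \<in> S" "gd s' x0 \<le> hr" "x \<in> I"
  shows "measure lborel (R x0) \<le> measure lborel (R x)"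
proof -
  have "gc s x \<le> hl" "gd s' x \<le> hr" using c_keep d_keep assms by auto
  then have "{c<..<d} \<subseteq> R x"
    using in_R_I[OF assms(1), of _ x] in_R_I[OF assms(3), of _ x]
    by (smt (verit) greaterThanLessThan_iff subsetI)
  from R_ge[OF this] have "d - c \<le> measure lborel (R x)" .
  moreover have "measure lborel (R x0) \<le> d - c"
    using seg_region_subset[of c d hl hr S "\<lambda>s. gc s x0" "\<lambda>s. gd s x0" on "\<lambda>s. y s x0"] cd
    by (intro R_le) auto
  ultimately show ?thesis by simp
qed

text \<open>Servers act only through \<open>c\<close> or from inside, so the served part is an
  initial interval. Its right end is a maximum of functions of \<open>x\<close>, each with an affine
  minorant touching it at \<open>x0\<close>; the function attaining the maximum at \<open>x0\<close>
  provides \<open>\<sigma>\<close>.\<close>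

lemma subgradient_left:
  assumes s0: "s0 \<in> S" "gc s0 x0 \<le> hl" and N: "\<And>s. s \<in> S \<Longrightarrow> gd s x0 > hr"
  shows "\<exists>\<sigma>. \<forall>x\<in>I. measure lborel (R x0) + \<sigma> * (x - x0) \<le> measure lborel (R x)"
proof -
  \<comment> \<open>\<open>U s x\<close> is where the route from \<open>s\<close> through
    \<open>c\<close> ties with the facilities reached through \<open>d\<close>; \<open>W s x\<close>
    is the same tie point for a server on the segment.\<close>
  define U where "U s x = (hr + d + c - gc s x) / 2" for s x
  define W where "W s x = (y s x + hr + d) / 2" for s x
  define K where "K = (\<lambda>s. U s x0) ` S \<union> (\<lambda>s. W s x0) ` {s\<in>S. on s}"
  define \<rho> where "\<rho> = Max K"
  have finK: "finite K" "K \<noteq> {}" using finS s0 by (auto simp: K_def)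
  have \<rho>: "\<rho> \<in> K" "\<And>k. k \<in> K \<Longrightarrow> k \<le> \<rho>" using Max_in[OF finK] Max_ge[OF finK(1)] by (auto simp: \<rho>_def)
  have U_le: "U s x0 \<le> \<rho>" if "s \<in> S" for s using that \<rho>(2) by (auto simp: K_def)
  have W_le: "W s x0 \<le> \<rho>" if "s \<in> S" "on s" for s using that \<rho>(2) by (auto simp: K_def)
  have "c \<le> U s0 x0" using s0 h_lip unfolding U_def by (simp add: field_simps)
  then have "c \<le> \<rho>" using U_le[OF s0(1)] by simp
  have "R x0 \<subseteq> {c..\<rho>}"
  proof
    fix t assume "t \<in> R x0"
    then obtain s where s: "s \<in> S" "c < t" "gc s x0 + (t - c) \<le> hr + (d - t) \<or> on s \<and> \<bar>t - y s x0\<bar> \<le> hr + (d - t)"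
      unfolding seg_region_iff using N by (metis not_le)
    then have "t \<le> U s x0 \<or> on s \<and> t \<le> W s x0"
      unfolding U_def W_def by (auto simp: field_simps)
    then show "t \<in> {c..\<rho>}" using U_le W_le s by fastforce
  qed
  then have up: "measure lborel (R x0) \<le> \<rho> - c" using R_le \<open>c \<le> \<rho>\<close> by simp
  from \<rho>(1) consider (1) s where "s \<in> S" "\<rho> = U s x0" | (2) s where "s \<in> S" "on s" "\<rho> = W s x0"
    unfolding K_def by auto
  then show ?thesis
  proof cases
    case 1
    \<comment> \<open>\<open>K\<close> includes servers that lose at \<open>c\<close>, but the
      largest \<open>U s x0\<close> belongs to the smallest \<open>gc s x0\<close>, which is at most
      \<open>gc s0 x0\<close>.\<close>
    then have "gc s x0 \<le> hl" using U_le[OF s0(1)] s0 by (auto simp: U_def)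
    obtain \<sigma> where \<sigma>: "\<And>x. x \<in> I \<Longrightarrow> gc s x \<le> gc s x0 + \<sigma> * (x - x0)" using gc_sup 1 by blast
    have "measure lborel (R x0) + (- \<sigma> / 2) * (x - x0) \<le> measure lborel (R x)" if x: "x \<in> I" for x
    proof -
      have "gc s x \<le> hl" using c_keep 1 x \<open>gc s x0 \<le> hl\<close> by blast
      have "gd s x \<ge> hr" using d_keep' 1 x N by blast
      then have "U s x \<le> d" using g_lip[OF 1(1) x] by (simp add: U_def field_simps)
      then have "{c<..<U s x} \<subseteq> R x"
        using \<open>gc s x \<le> hl\<close> 1 by (auto intro!: in_R_I[of s] simp: U_def field_simps)
      from R_ge[OF this] have "U s x - c \<le> measure lborel (R x)" .
      moreover have "U s x0 + (- \<sigma> / 2) * (x - x0) \<le> U s x"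
        using \<sigma>[OF x] by (simp add: U_def field_simps)
      ultimately show ?thesis using up 1 by linarith
    qed
    then show ?thesis by blast
  next
    case 2
    obtain \<tau> where \<tau>: "\<And>x. x \<in> I \<Longrightarrow> y s x = y s x0 + \<tau> * (x - x0)" using y_aff 2 by blast
    have "measure lborel (R x0) + (\<tau> / 2) * (x - x0) \<le> measure lborel (R x)" if x: "x \<in> I" for x
    proof -
      have g0: "gc s0 x \<le> hl" using c_keep s0 x by blast
      have yx: "c \<le> y s x" "y s x \<le> d" using y_in 2 x by auto
      have "gd s x \<ge> hr" using d_keep' 2 x N by blast
      then have Wd: "W s x \<le> d" using y_gd[OF 2(1,2) x] by (simp add: W_def field_simps)
      have "{c<..<W s x} \<subseteq> R x"
      proof
        fix t assume t: "t \<in> {c<..<W s x}"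
        \<comment> \<open>Server \<open>s\<close> beats the facilities reached through
          \<open>c\<close> only from the tie point \<open>(y s x - hl + c) / 2\<close> on; farther
          left, \<open>s0\<close> serves through \<open>c\<close>.\<close>
        show "t \<in> R x"
        proof (cases "t \<ge> (y s x - hl + c) / 2")
          case True
          then have "\<bar>t - y s x\<bar> \<le> hl + (t - c) \<and> \<bar>t - y s x\<bar> \<le> hr + (d - t)"
            using t yx h_nonneg by (auto simp: W_def abs_le_iff field_simps)
          then show ?thesis using in_R_I[of s t x] 2 t Wd by auto
        next
          case False
          then have "gc s0 x + (t - c) \<le> hr + (d - t)"
            using g0 yx h_nonneg by (simp add: field_simps)
          then show ?thesis using in_R_I[of s0 t x] s0 g0 t Wd by auto
        qed
      qed
      from R_ge[OF this] have "W s x - c \<le> measure lborel (R x)" .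
      moreover have "W s x0 + (\<tau> / 2) * (x - x0) = W s x"
        using \<tau>[OF x] by (simp add: W_def field_simps)
      ultimately show ?thesis using up 2 by linarith
    qed
    then show ?thesis by blast
  qed
qed

text \<open>Only servers on the segment can serve its points now. Each reaches an interval
  containing the midpoint \<open>(c + d) / 2\<close>, so the union is one interval, bounded by the
  leftmost server on the left and by the rightmost on the right.\<close>

lemma subgradient_none:
  assumes Nc: "\<And>s. s \<in> S \<Longrightarrow> gc s x0 > hl" and Nd: "\<And>s. s \<in> S \<Longrightarrow> gd s x0 > hr"
  shows "\<exists>\<sigma>. \<forall>x\<in>I. measure lborel (R x0) + \<sigma> * (x - x0) \<le> measure lborel (R x)"
proof -
  define X where "X = {s\<in>S. on s}"
  have R0: "\<exists>s\<in>X. (y s x0 - hl + c) / 2 \<le> t \<and> t \<le> (y s x0 + hr + d) / 2" if t: "t \<in> R x0" for t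
  proof -
    obtain s where "s \<in> S" "on s" "\<bar>t - y s x0\<bar> \<le> hl + (t - c)" "\<bar>t - y s x0\<bar> \<le> hr + (d - t)"
      using t Nc Nd unfolding seg_region_iff by (metis not_le)
    then show ?thesis unfolding X_def by (intro bexI[of _ s]) (auto simp: field_simps)
  qed
  show ?thesis
  proof (cases "X = {}")
    case True
    then have "R x0 = {}" using R0 by blast
    then have "\<forall>x\<in>I. measure lborel (R x0) + 0 * (x - x0) \<le> measure lborel (R x)" by simp
    then show ?thesis by blast
  next
    case False
    have finX: "finite ((\<lambda>s. y s x0) ` X)" "(\<lambda>s. y s x0) ` X \<noteq> {}" using finS False by (auto simp: X_def)
    obtain i where i: "i \<in> X" "y i x0 = Min ((\<lambda>s. y s x0) ` X)" using Min_in[OF finX] by auto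
    obtain j where j: "j \<in> X" "y j x0 = Max ((\<lambda>s. y s x0) ` X)" using Max_in[OF finX] by auto
    have ij: "y i x0 \<le> y s x0" "y s x0 \<le> y j x0" if "s \<in> X" for s
      using that Min_le[OF finX(1)] Max_ge[OF finX(1)] by (auto simp: i(2) j(2))
    have iS: "i \<in> S" "on i" and jS: "j \<in> S" "on j" using i j by (auto simp: X_def)
    define l where "l x = (y i x - hl + c) / 2" for x
    define u where "u x = (y j x + hr + d) / 2" for x
    obtain \<tau> where \<tau>: "\<And>x. x \<in> I \<Longrightarrow> y i x = y i x0 + \<tau> * (x - x0)" using y_aff iS by blast
    obtain \<tau>' where \<tau>': "\<And>x. x \<in> I \<Longrightarrow> y j x = y j x0 + \<tau>' * (x - x0)" using y_aff jS by blast
    have lu: "l x \<le> u x" if "x \<in> I" for x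
      using y_in[OF iS that] y_in[OF jS that] h_nonneg by (auto simp: l_def u_def)
    have "R x0 \<subseteq> {l x0..u x0}"
    proof
      fix t assume "t \<in> R x0"
      then obtain s where "s \<in> X" "(y s x0 - hl + c) / 2 \<le> t" "t \<le> (y s x0 + hr + d) / 2"
        using R0 by blast
      then show "t \<in> {l x0..u x0}" using ij[of s] by (simp add: l_def u_def)
    qed
    then have up: "measure lborel (R x0) \<le> u x0 - l x0" using R_le lu x0 by blast
    \<comment> \<open>\<open>i\<close> and \<open>j\<close> are known to be extreme at
      \<open>x0\<close> only. For other \<open>x\<close> a lower bound suffices, and their two
      intervals still overlap.\<close>
    have "measure lborel (R x0) + ((\<tau>' - \<tau>) / 2) * (x - x0) \<le> measure lborel (R x)" if x: "x \<in> I" for x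
    proof -
      have yi: "c \<le> y i x" "y i x \<le> d" and yj: "c \<le> y j x" "y j x \<le> d"
        using y_in iS jS x by auto
      have "gc i x \<ge> hl" "gd j x \<ge> hr" using c_keep' d_keep' iS jS x Nc Nd by blast+
      then have cl: "c \<le> l x" and ud: "u x \<le> d"
        using y_gc[OF iS x] y_gd[OF jS x] by (auto simp: l_def u_def)
      have "{l x<..<u x} \<subseteq> R x"
      proof
        fix t assume t: "t \<in> {l x<..<u x}"
        show "t \<in> R x"
        proof (cases "t \<le> (y i x + hr + d) / 2")
          case True
          then have "\<bar>t - y i x\<bar> \<le> hl + (t - c) \<and> \<bar>t - y i x\<bar> \<le> hr + (d - t)"
            using t yi h_nonneg by (auto simp: l_def abs_le_iff field_simps)
          then show ?thesis using in_R_I[of i t x] iS t cl ud by auto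
        next
          case False
          then have "\<bar>t - y j x\<bar> \<le> hl + (t - c) \<and> \<bar>t - y j x\<bar> \<le> hr + (d - t)"
            using t yi yj h_nonneg by (auto simp: u_def abs_le_iff field_simps)
          then show ?thesis using in_R_I[of j t x] jS t cl ud by auto
        qed
      qed
      from R_ge[OF this] have "u x - l x \<le> measure lborel (R x)" .
      moreover have "u x0 - l x0 + ((\<tau>' - \<tau>) / 2) * (x - x0) = u x - l x"
        using \<tau>[OF x] \<tau>'[OF x] by (simp add: l_def u_def field_simps)
      ultimately show ?thesis using up by linarith
    qed
    then show ?thesis by blast
  qed
qed

text \<open>The segment is reflected but the parameter \<open>x\<close> is not, so a slope found for
  the mirror image carries over unchanged.\<close>

lemma segment_servers_uminus:
  "segment_servers (- d) (- c) hr hl x0 I S gd gc (\<lambda>s x. - y s x) on"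
proof
  show "\<exists>\<tau>. \<forall>x\<in>I. - y s x = - y s x0 + \<tau> * (x - x0)" if s: "s \<in> S" "on s" for s
  proof -
    obtain \<tau> where "\<forall>x\<in>I. y s x = y s x0 + \<tau> * (x - x0)" using y_aff s by blast
    then show ?thesis by (intro exI[of _ "- \<tau>"]) auto
  qed
qed (use cd finS x0 h_nonneg h_lip g_lip gc_sup gd_sup y_in y_gc y_gd c_keep c_keep' d_keep d_keep'
     in \<open>simp_all add: abs_minus_commute\<close>)

theorem subgradient:
  "\<exists>\<sigma>. \<forall>x\<in>I. measure lborel (R x0) + \<sigma> * (x - x0) \<le> measure lborel (R x)"
proof (cases "\<exists>s\<in>S. gc s x0 \<le> hl")
  case c: True
  show ?thesis
  proof (cases "\<exists>s\<in>S. gd s x0 \<le> hr")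
    case True
    with c have "\<forall>x\<in>I. measure lborel (R x0) + 0 * (x - x0) \<le> measure lborel (R x)"
      using subgradient_both by auto
    then show ?thesis by blast
  next
    case False
    with c subgradient_left show ?thesis by force
  qed
next
  case c: False
  show ?thesis
  proof (cases "\<exists>s\<in>S. gd s x0 \<le> hr")
    case True
    then obtain s where "s \<in> S" "gd s x0 \<le> hr" by blast
    from segment_servers.subgradient_left[OF segment_servers_uminus this] c
    show ?thesis
      by (simp add: seg_region_uminus measure_lborel_uminus seg_region_sets finS not_le)
  next
    case False
    with c subgradient_none show ?thesis by force
  qed
qed

end

section \<open>Metric graphs\<close>

locale metric_graph =
  fixes V :: "'v::linorder set" and E :: "('v \<times> 'v) set" and wl :: "'v \<times> 'v \<Rightarrow> real"
  assumes finV: "finite V"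
    and EV: "E \<subseteq> V \<times> V"
    and Eord: "\<forall>(a, b)\<in>E. a < b"
    and wl_pos: "\<forall>e\<in>E. wl e > 0"
    and conn: "\<forall>u\<in>V. \<forall>v\<in>V. \<exists>xs. is_walk E u v xs"
begin

lemma finE: "finite E"
  using finV EV by (meson finite_SigmaI finite_subset)

lemma edgeD:
  assumes "(a, b) \<in> E"
  shows "a \<in> V" "b \<in> V" "a < b" "wl (a, b) > 0"
  using assms EV Eord wl_pos by auto

lemma elen_sym: "adj E a b \<Longrightarrow> elen E wl a b = elen E wl b a"
  unfolding adj_def elen_def using edgeD(3)[of a b] edgeD(3)[of b a] by auto

lemma adj_sym: "adj E a b \<longleftrightarrow> adj E b a"
  by (auto simp: adj_def)

lemma elen_pos: "adj E a b \<Longrightarrow> elen E wl a b > 0"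
  using wl_pos by (auto simp: adj_def elen_def)

section \<open>Walks and the distance between vertices\<close>

lemma is_walk_single [simp]: "is_walk E u v [x] \<longleftrightarrow> x = u \<and> x = v"
  by (auto simp: is_walk_def)

lemma is_walk_Cons [simp]:
  "is_walk E u v (x # y # ys) \<longleftrightarrow> x = u \<and> adj E x y \<and> is_walk E y v (y # ys)"
  by (auto simp: is_walk_def nth_Cons split: nat.splits)

lemma walk_len_single [simp]: "walk_len E wl [x] = 0"
  by (simp add: walk_len_def)

lemma walk_len_Cons [simp]:
  "walk_len E wl (x # y # ys) = elen E wl x y + walk_len E wl (y # ys)"
  by (simp add: walk_len_def)

lemma is_walk_Nil [simp]: "\<not> is_walk E u v []"
  by (simp add: is_walk_def)

lemma walk_len_nonneg: "is_walk E u v xs \<Longrightarrow> walk_len E wl xs \<ge> 0"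
proof (induction xs arbitrary: u rule: induct_list012)
  case (3 x y zs)
  then show ?case using elen_pos[of x y] by fastforce
qed auto

text \<open>\<open>tl ys\<close> drops the joining vertex \<open>v\<close>, which already ends
  \<open>xs\<close>.\<close>

lemma walk_append:
  assumes "is_walk E u v xs" "is_walk E v w ys"
  shows "is_walk E u w (xs @ tl ys) \<and>
         walk_len E wl (xs @ tl ys) = walk_len E wl xs + walk_len E wl ys"
  using assms(1)
proof (induction xs arbitrary: u rule: induct_list012)
  case 1 then show ?case by simp
next
  case (2 x)
  then have "ys = x # tl ys" using assms(2) by (cases ys; cases "tl ys") auto
  with 2 assms(2) show ?case by (metis append_Cons append_Nil is_walk_single add_0 walk_len_single)
next
  case (3 x y zs)
  then show ?case by auto
qed

lemma walk_rev:
  assumes "is_walk E u v xs"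
  shows "is_walk E v u (rev xs) \<and> walk_len E wl (rev xs) = walk_len E wl xs"
  using assms
proof (induction xs arbitrary: u rule: induct_list012)
  case (3 x y zs)
  then have IH: "is_walk E v y (rev (y # zs))"
      "walk_len E wl (rev (y # zs)) = walk_len E wl (y # zs)" by auto
  have "is_walk E y x [y, x]" using 3 adj_sym[of x y] by auto
  from walk_append[OF IH(1) this] 3 IH(2) elen_sym[of x y] show ?case by auto
qed auto

lemma vdist_bdd: "bdd_below {walk_len E wl xs | xs. is_walk E u v xs}"
  by (rule bdd_belowI[of _ 0]) (use walk_len_nonneg in auto)

lemma vdist_le: "is_walk E u v xs \<Longrightarrow> vdist E wl u v \<le> walk_len E wl xs"
  unfolding vdist_def by (rule cInf_lower[OF _ vdist_bdd]) auto

text \<open>Connectedness supplies a walk, so the infimum is over a nonempty set.\<close>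

lemma vdist_ge:
  assumes "u \<in> V" "v \<in> V" "\<And>xs. is_walk E u v xs \<Longrightarrow> c \<le> walk_len E wl xs"
  shows "c \<le> vdist E wl u v"
  unfolding vdist_def by (rule cInf_greatest) (use assms conn in auto)

lemma vdist_nonneg: "u \<in> V \<Longrightarrow> v \<in> V \<Longrightarrow> vdist E wl u v \<ge> 0"
  by (rule vdist_ge) (use walk_len_nonneg in auto)

lemma vdist_refl [simp]: "u \<in> V \<Longrightarrow> vdist E wl u u = 0"
  using vdist_le[of u u "[u]"] vdist_nonneg[of u u] by simp

lemma vdist_sym: "vdist E wl u v = vdist E wl v u"
proof -
  have "{walk_len E wl xs | xs. is_walk E u v xs} \<subseteq> {walk_len E wl xs | xs. is_walk E v u xs}" for u v
    using walk_rev by (auto; metis)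
  then show ?thesis unfolding vdist_def by (metis (lifting) subset_antisym)
qed

lemma vdist_triangle:
  assumes "u \<in> V" "v \<in> V" "w \<in> V"
  shows "vdist E wl u w \<le> vdist E wl u v + vdist E wl v w"
proof -
  \<comment> \<open>The two infima are treated in turn: first over walks from \<open>v\<close> to
    \<open>w\<close> with \<open>xs\<close> fixed, then over \<open>xs\<close>.\<close>
  have "vdist E wl u w - walk_len E wl xs \<le> vdist E wl v w" if "is_walk E u v xs" for xs
    by (rule vdist_ge) (use assms vdist_le walk_append[OF that] in \<open>force+\<close>)
  then have "vdist E wl u w - vdist E wl v w \<le> vdist E wl u v"
    by (intro vdist_ge) (use assms in \<open>force+\<close>)
  then show ?thesis by simp
qed

lemma vdist_edge: "(a, b) \<in> E \<Longrightarrow> vdist E wl a b \<le> wl (a, b)"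
  using vdist_le[of a b "[a, b]"] by (auto simp: adj_def elen_def)

lemma vdist_pos:
  assumes "u \<in> V" "v \<in> V" "u \<noteq> v"
  shows "vdist E wl u v > 0"
proof -
  have fin: "finite (wl ` E)" using finE by simp
  \<comment> \<open>The first edge of a walk between different vertices already has length at least
    \<open>m\<close>. The extra 1 keeps \<open>Min\<close> defined if there is no edge.\<close>
  define m where "m = Min (insert 1 (wl ` E))"
  have "m > 0" unfolding m_def using fin wl_pos by auto
  have le: "m \<le> elen E wl x y" if "adj E x y" for x y
    using that fin unfolding m_def adj_def elen_def by (auto intro!: Min_le)
  have "m \<le> vdist E wl u v"
  proof (rule vdist_ge[OF assms(1,2)])
    fix xs assume w: "is_walk E u v xs"
    then obtain y ys where xs: "xs = u # y # ys"
      using assms(3) by (cases xs; cases "tl xs") auto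
    then show "m \<le> walk_len E wl xs"
      using w le[of u y] walk_len_nonneg[of y v "y # ys"] by auto
  qed
  with \<open>m > 0\<close> show ?thesis by simp
qed

section \<open>Distances between points of the graph\<close>

abbreviation "P \<equiv> Pts V E wl"
abbreviation "vd \<equiv> vdist E wl"
abbreviation "pd \<equiv> pdist E wl"
abbreviation "sd \<equiv> dist_to_set E wl"

declare pdist.simps [simp del]

text \<open>A vertex fits in as two equal anchors \<open>(u, 0)\<close>, so this single computation
  yields all four distance formulas.\<close>

lemma Min_anchors: "Min {s + vd x y + r | x s y r. (x, s) \<in> {(a, t), (b, u)} \<and> (y, r) \<in> {(a', t'), (b', u')}}
   = min (min (t + vd a a' + t') (t + vd a b' + u')) (min (u + vd b a' + t') (u + vd b b' + u'))"
proof -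
  have "{s + vd x y + r | x s y r. (x, s) \<in> {(a, t), (b, u)} \<and> (y, r) \<in> {(a', t'), (b', u')}}
     = {t + vd a a' + t', t + vd a b' + u', u + vd b a' + t', u + vd b b' + u'}" by auto
  then show ?thesis by (simp add: min.assoc)
qed

lemma pdist_VV: "pd (Vx u) (Vx v) = vd u v"
  using Min_anchors[of u 0 u 0 v 0 v 0]
  by (simp only: pdist.simps anch.simps insert_absorb2 min.idem add_0_left add_0_right)

lemma pdist_VE: "pd (Vx u) (Ed a b t) = min (vd u a + t) (vd u b + (wl (a, b) - t))"
  using Min_anchors[of u 0 u 0 a t b "wl (a, b) - t"]
  by (simp only: pdist.simps anch.simps insert_absorb2 min.idem add_0_left add_0_right)

lemma pdist_EV: "pd (Ed a b t) (Vx u) = min (t + vd a u) (wl (a, b) - t + vd b u)"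
  using Min_anchors[of a t b "wl (a, b) - t" u 0 u 0]
  by (simp only: pdist.simps anch.simps insert_absorb2 min.idem add_0_left add_0_right)

lemma pdist_EE: "pd (Ed a b t) (Ed a' b' t') =
   (let base = min (min (t + vd a a' + t') (t + vd a b' + (wl (a', b') - t')))
       (min (wl (a, b) - t + vd b a' + t') (wl (a, b) - t + vd b b' + (wl (a', b') - t')))
    in if a = a' \<and> b = b' then min base \<bar>t - t'\<bar> else base)"
  by (simp only: pdist.simps anch.simps Min_anchors)

lemmas pdist_eqs = pdist_VV pdist_VE pdist_EV pdist_EE

lemma pdist_sym: "pd p q = pd q p"
proof -
  let ?D = "\<lambda>A B. {s + vd x y + r | x s y r. (x, s) \<in> A \<and> (y, r) \<in> B}"
  have "?D A B \<subseteq> ?D B A" for A B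
  proof
    fix z assume "z \<in> ?D A B"
    then obtain x s y r where "z = s + vd x y + r" "(x, s) \<in> A" "(y, r) \<in> B" by auto
    then have "z = r + vd y x + s \<and> (y, r) \<in> B \<and> (x, s) \<in> A"
      by (simp add: vdist_sym[of x y])
    then show "z \<in> ?D B A" by blast
  qed
  then have "?D A B = ?D B A" for A B by (meson subset_antisym)
  then have *: "Min (?D A B) = Min (?D B A)" for A B by metis
  show ?thesis
  proof (cases p; cases q)
    fix a b t a' b' t' assume pq: "p = Ed a b t" "q = Ed a' b' t'"
    show ?thesis
      unfolding pq pdist.simps *[of "anch wl (Ed a b t)"] Let_def
        abs_minus_commute[of t] eq_commute[of a] eq_commute[of b] ..
  qed (simp_all only: pdist.simps, (rule *)+)
qed

lemma P_V [simp]: "Vx v \<in> P \<longleftrightarrow> v \<in> V"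
  by (auto simp: Pts_def)

lemma P_E [simp]: "Ed a b t \<in> P \<longleftrightarrow> (a, b) \<in> E \<and> 0 < t \<and> t < wl (a, b)"
  by (auto simp: Pts_def)

lemma pdist_nonneg: "p \<in> P \<Longrightarrow> q \<in> P \<Longrightarrow> pd p q \<ge> 0"
  by (cases p; cases q; auto simp: pdist_eqs Let_def edgeD vdist_nonneg)

lemma pdist_refl: "p \<in> P \<Longrightarrow> pd p p = 0"
  using pdist_nonneg[of p p] by (cases p) (auto simp: pdist_eqs Let_def)

lemma pdist_pos:
  assumes "p \<in> P" "q \<in> P" "p \<noteq> q"
  shows "pd p q > 0"
proof -
  have EE: "pd (Ed a b t) (Ed a' b' t') > 0"
    if "(a, b) \<in> E" "0 < t" "t < wl (a, b)" "(a', b') \<in> E" "0 < t'" "t' < wl (a', b')"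
      "\<not> (a = a' \<and> b = b' \<and> t = t')" for a b t a' b' t'
  proof -
    have "vd a a' \<ge> 0" "vd a b' \<ge> 0" "vd b a' \<ge> 0" "vd b b' \<ge> 0"
      using edgeD[OF that(1)] edgeD[OF that(4)] by (auto intro: vdist_nonneg)
    then show ?thesis using that(2,3,5,6,7) unfolding pdist_EE Let_def
      by (smt (verit))
  qed
  have VE: "pd (Vx u) (Ed a b t) > 0"
    if "u \<in> V" "(a, b) \<in> E" "0 < t" "t < wl (a, b)" for u a b t
    using that vdist_nonneg[of u a] vdist_nonneg[of u b] edgeD[of a b] by (simp add: pdist_VE)
  have EV: "pd (Ed a b t) (Vx u) > 0"
    if "u \<in> V" "(a, b) \<in> E" "0 < t" "t < wl (a, b)" for u a b t
    using VE[OF that] pdist_sym[of "Ed a b t" "Vx u"] by simp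
  show ?thesis
  proof (cases p; cases q)
    fix u v assume "p = Vx u" "q = Vx v"
    then show ?thesis using assms vdist_pos[of u v] by (simp add: pdist_VV)
  qed (use assms in \<open>auto intro: EE VE EV\<close>)
qed

end

section \<open>Distances along an edge\<close>

text \<open>A change of sign between \<open>x0\<close> and \<open>x\<close> would force a zero
  strictly between them. The end points may be zeros themselves, hence the weak inequality.\<close>

lemma sign_persists:
  fixes \<phi> :: "real \<Rightarrow> real"
  assumes cont: "continuous_on {\<alpha>..\<beta>} \<phi>" and x0: "\<alpha> < x0" "x0 < \<beta>"
    and nz: "\<And>x. \<alpha> < x \<Longrightarrow> x < \<beta> \<Longrightarrow> \<phi> x \<noteq> 0" and pos: "\<phi> x0 > 0"
    and x: "x \<in> {\<alpha>..\<beta>}"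
  shows "\<phi> x \<ge> 0"
proof (rule ccontr)
  assume neg: "\<not> \<phi> x \<ge> 0"
  have conn: "connected (\<phi> ` closed_segment x x0)"
    using cont x x0
    by (intro connected_continuous_image continuous_on_subset[OF cont])
      (auto simp: closed_segment_eq_real_ivl split: if_splits)
  have "0 \<in> \<phi> ` closed_segment x x0"
    using connectedD_interval[OF conn, of "\<phi> x" "\<phi> x0" 0] neg pos by auto
  then obtain z where z: "z \<in> closed_segment x x0" "\<phi> z = 0" by auto
  have "z \<noteq> x" "z \<noteq> x0" using z neg pos by auto
  then have "\<alpha> < z" "z < \<beta>" using z x x0 by (auto simp: closed_segment_eq_real_ivl split: if_splits)
  then show False using nz z by blast
qed

context metric_graph
begin

text \<open>\<open>Ed\<close> covers only interior points. Here the ends of the edge are included as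
  vertices, so that a sliding point can come to rest there; other coordinates are clamped.\<close>

definition pt :: "'v \<Rightarrow> 'v \<Rightarrow> real \<Rightarrow> 'v point" where
  "pt a b t = (if t \<le> 0 then Vx a else if t \<ge> wl (a, b) then Vx b else Ed a b t)"

lemma pt_in: "(a, b) \<in> E \<Longrightarrow> pt a b t \<in> P"
  using edgeD[of a b] by (auto simp: pt_def)

lemma pt_open: "0 < t \<Longrightarrow> t < wl (a, b) \<Longrightarrow> pt a b t = Ed a b t"
  by (simp add: pt_def)

lemma pt_0: "pt a b 0 = Vx a"
  by (simp add: pt_def)

lemma pt_wl: "(a, b) \<in> E \<Longrightarrow> pt a b (wl (a, b)) = Vx b"
  using edgeD[of a b] by (simp add: pt_def)

lemma pt_eq_Ed: "pt a b t = Ed a' b' y \<longleftrightarrow> a' = a \<and> b' = b \<and> y = t \<and> 0 < t \<and> t < wl (a, b)"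
  by (auto simp: pt_def)

lemma vd_edge_lip:
  assumes "(a, b) \<in> E" "u \<in> V"
  shows "vd u a \<le> vd u b + wl (a, b)" "vd u b \<le> vd u a + wl (a, b)"
  using edgeD[OF assms(1)] vdist_edge[OF assms(1)] vdist_sym[of a b]
    vdist_triangle[of u b a] vdist_triangle[of u a b] assms(2) by auto

lemma pd_Vx_lip:
  assumes "(a, b) \<in> E" "q \<in> P"
  shows "pd q (Vx a) \<le> pd q (Vx b) + wl (a, b)" "pd q (Vx b) \<le> pd q (Vx a) + wl (a, b)"
proof -
  have "pd q (Vx a) \<le> pd q (Vx b) + wl (a, b) \<and> pd q (Vx b) \<le> pd q (Vx a) + wl (a, b)"
  proof (cases q)
    case (Vx v)
    then show ?thesis using assms vd_edge_lip[OF assms(1), of v] by (simp add: pdist_VV)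
  next
    case (Ed a' b' x)
    then have "a' \<in> V" "b' \<in> V" using assms edgeD by auto
    then show ?thesis
      using vd_edge_lip[OF assms(1), of a'] vd_edge_lip[OF assms(1), of b'] vdist_sym
      unfolding Ed pdist_EV by linarith
  qed
  then show "pd q (Vx a) \<le> pd q (Vx b) + wl (a, b)" "pd q (Vx b) \<le> pd q (Vx a) + wl (a, b)"
    by auto
qed

text \<open>From a point not inside the edge, every route enters through \<open>a\<close> or
  \<open>b\<close>. At the ends the formula holds because the distances to \<open>a\<close> and
  \<open>b\<close> differ by at most the edge length.\<close>

lemma pd_pt_off:
  assumes ab: "(a, b) \<in> E" and q: "q \<in> P" and t: "0 \<le> t" "t \<le> wl (a, b)"
    and off: "\<And>x. q \<noteq> Ed a b x"
  shows "pd q (pt a b t) = min (pd q (Vx a) + t) (pd q (Vx b) + (wl (a, b) - t))"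
proof -
  consider "t = 0" | "t = wl (a, b)" | "0 < t" "t < wl (a, b)" using t by linarith
  then show ?thesis
  proof cases
    case 1 then show ?thesis using pd_Vx_lip[OF ab q] by (simp add: pt_0)
  next
    case 2 then show ?thesis using pd_Vx_lip[OF ab q] by (simp add: pt_wl[OF ab])
  next
    case 3
    show ?thesis
    proof (cases q)
      case (Vx v) then show ?thesis by (simp add: pt_open[OF 3] pdist_VE pdist_VV)
    next
      case (Ed a' b' x)
      then have "\<not> (a' = a \<and> b' = b)" using off by auto
      then show ?thesis
        unfolding pt_open[OF 3] Ed pdist_EE pdist_EV Let_def if_not_P[OF \<open>\<not> (a' = a \<and> b' = b)\<close>]
        by (simp only: min_add_distrib_left min.assoc min.left_commute)
    qed
  qed
qed

text \<open>The direct route along the edge is a third choice here, and the distances to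
  \<open>Vx a\<close> and \<open>Vx b\<close> may themselves use a detour through the opposite
  end.\<close>

lemma pd_pt_pt:
  assumes ab: "(a, b) \<in> E" and t: "0 \<le> t" "t \<le> wl (a, b)" and x: "0 \<le> x" "x \<le> wl (a, b)"
  shows "pd (pt a b x) (pt a b t) =
    min (min (pd (pt a b x) (Vx a) + t) (pd (pt a b x) (Vx b) + (wl (a, b) - t))) \<bar>x - t\<bar>"
proof -
  note V = edgeD[OF ab]
  have vab: "vd a b \<le> wl (a, b)" "vd a b \<ge> 0" "vd b a = vd a b" "vd a a = 0" "vd b b = 0"
    using V vdist_edge[OF ab] vdist_nonneg vdist_sym by auto
  consider "x = 0" | "x = wl (a, b)" | "0 < x" "x < wl (a, b)" using x by linarith
  then show ?thesis
  proof cases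
    case 1
    then show ?thesis using pd_pt_off[OF ab, of "Vx a" t] t V vab by (auto simp: pt_0 pdist_VV)
  next
    case 2
    then show ?thesis using pd_pt_off[OF ab, of "Vx b" t] t V vab
      by (auto simp: pt_wl[OF ab] pdist_VV)
  next
    case 3
    note x = this
    have A: "pd (Ed a b x) (Vx a) = min x (wl (a, b) - x + vd a b)"
      "pd (Ed a b x) (Vx b) = min (x + vd a b) (wl (a, b) - x)"
      by (simp_all add: pdist_EV vab)
    consider "t = 0" | "t = wl (a, b)" | "0 < t" "t < wl (a, b)" using t by linarith
    then show ?thesis
    proof cases
      case 1 then show ?thesis
        unfolding pt_open[OF x] 1 pt_0 A using x vab by linarith
    next
      case 2 then show ?thesis
        unfolding pt_open[OF x] 2 pt_wl[OF ab] A using x vab by linarith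
    next
      case 3
      show ?thesis
        unfolding pt_open[OF x] pt_open[OF 3] pdist_EE A Let_def vab if_P[OF conjI[OF refl refl]]
        by (simp only: min_add_distrib_left add_0_right min.assoc min.left_commute)
    qed
  qed
qed

text \<open>Upper bounds together with the fact that one is attained: later arguments can follow a
  shortest route without unfolding the minimum or asking where \<open>q\<close> lies.\<close>

lemma pd_pt_le:
  assumes ab: "(a, b) \<in> E" and q: "q \<in> P" and t: "0 \<le> t" "t \<le> wl (a, b)"
  shows "pd q (pt a b t) \<le> pd q (Vx a) + t"
    and "pd q (pt a b t) \<le> pd q (Vx b) + (wl (a, b) - t)"
    and "q = Ed a b x \<Longrightarrow> pd q (pt a b t) \<le> \<bar>x - t\<bar>"
    and "pd q (pt a b t) = pd q (Vx a) + t \<or> pd q (pt a b t) = pd q (Vx b) + (wl (a, b) - t)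
      \<or> (\<exists>x. q = Ed a b x \<and> pd q (pt a b t) = \<bar>x - t\<bar>)"
proof -
  have "pd q (pt a b t) \<le> pd q (Vx a) + t \<and> pd q (pt a b t) \<le> pd q (Vx b) + (wl (a, b) - t) \<and>
    (\<forall>x. q = Ed a b x \<longrightarrow> pd q (pt a b t) \<le> \<bar>x - t\<bar>) \<and>
    (pd q (pt a b t) = pd q (Vx a) + t \<or> pd q (pt a b t) = pd q (Vx b) + (wl (a, b) - t)
      \<or> (\<exists>x. q = Ed a b x \<and> pd q (pt a b t) = \<bar>x - t\<bar>))"
  proof (cases "\<exists>x. q = Ed a b x")
    case True
    then obtain x where xq: "q = Ed a b x" by blast
    then have x: "pt a b x = q" "0 \<le> x" "x \<le> wl (a, b)" using q by (auto simp: pt_open)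
    have min3: "min (min u v) w \<le> u" "min (min u v) w \<le> v" "min (min u v) w \<le> w"
      "min (min u v) w = u \<or> min (min u v) w = v \<or> min (min u v) w = w" for u v w :: real
      by linarith+
    have e: "pd q (pt a b t) = min (min (pd q (Vx a) + t) (pd q (Vx b) + (wl (a, b) - t))) \<bar>x - t\<bar>"
      using pd_pt_pt[OF ab t x(2,3)] unfolding x(1) .
    have "pd q (pt a b t) \<le> pd q (Vx a) + t" "pd q (pt a b t) \<le> pd q (Vx b) + (wl (a, b) - t)"
      "pd q (pt a b t) \<le> \<bar>x - t\<bar>" "pd q (pt a b t) = pd q (Vx a) + t \<or>
        pd q (pt a b t) = pd q (Vx b) + (wl (a, b) - t) \<or> pd q (pt a b t) = \<bar>x - t\<bar>"
      unfolding e by (rule min3)+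
    then show ?thesis using xq by auto
  next
    case False
    then have "pd q (pt a b t) = min (pd q (Vx a) + t) (pd q (Vx b) + (wl (a, b) - t))"
      using pd_pt_off[OF ab q t] by blast
    then have "pd q (pt a b t) \<le> pd q (Vx a) + t" "pd q (pt a b t) \<le> pd q (Vx b) + (wl (a, b) - t)"
      "pd q (pt a b t) = pd q (Vx a) + t \<or> pd q (pt a b t) = pd q (Vx b) + (wl (a, b) - t)"
      by linarith+
    then show ?thesis using False by blast
  qed
  then show "pd q (pt a b t) \<le> pd q (Vx a) + t"
    "pd q (pt a b t) \<le> pd q (Vx b) + (wl (a, b) - t)"
    "q = Ed a b x \<Longrightarrow> pd q (pt a b t) \<le> \<bar>x - t\<bar>"
    "pd q (pt a b t) = pd q (Vx a) + t \<or> pd q (pt a b t) = pd q (Vx b) + (wl (a, b) - t)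
      \<or> (\<exists>x. q = Ed a b x \<and> pd q (pt a b t) = \<bar>x - t\<bar>)" by auto
qed

lemma pd_pt_lip:
  assumes ab: "(a, b) \<in> E" and q: "q \<in> P" and t: "0 \<le> t" "t \<le> wl (a, b)" "0 \<le> t'" "t' \<le> wl (a, b)"
  shows "pd q (pt a b t) \<le> pd q (pt a b t') + \<bar>t - t'\<bar>"
  using pd_pt_le(4)[OF ab q t(3,4)]
proof (elim disjE exE conjE)
  assume "pd q (pt a b t') = pd q (Vx a) + t'"
  then show ?thesis using pd_pt_le(1)[OF ab q t(1,2)] by linarith
next
  assume "pd q (pt a b t') = pd q (Vx b) + (wl (a, b) - t')"
  then show ?thesis using pd_pt_le(2)[OF ab q t(1,2)] by linarith
next
  fix x assume "q = Ed a b x" "pd q (pt a b t') = \<bar>x - t'\<bar>"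
  then show ?thesis using pd_pt_le(3)[OF ab q t(1,2)] by fastforce
qed

text \<open>The upper bound is the Lipschitz property. Conversely, a shortest route to
  \<open>t\<close> arrives through \<open>a\<close>, through \<open>b\<close>, or directly from a
  point of the edge not strictly between \<open>c\<close> and \<open>d\<close>, and in each case it
  passes \<open>c\<close> or \<open>d\<close>.\<close>

lemma pd_seg_off:
  assumes ab: "(a, b) \<in> E" and q: "q \<in> P" and t: "0 \<le> c" "c \<le> t" "t \<le> d" "d \<le> wl (a, b)"
    and off: "\<And>x. c < x \<Longrightarrow> x < d \<Longrightarrow> q \<noteq> Ed a b x"
  shows "pd q (pt a b t) = min (pd q (pt a b c) + (t - c)) (pd q (pt a b d) + (d - t))"
proof (rule antisym)
  have c: "0 \<le> c" "c \<le> wl (a, b)" and d: "0 \<le> d" "d \<le> wl (a, b)" and t': "0 \<le> t" "t \<le> wl (a, b)"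
    using t by auto
  show "pd q (pt a b t) \<le> min (pd q (pt a b c) + (t - c)) (pd q (pt a b d) + (d - t))"
    using pd_pt_lip[OF ab q t' c] pd_pt_lip[OF ab q t' d] t by simp
  have "pd q (pt a b c) + (t - c) \<le> pd q (pt a b t) \<or> pd q (pt a b d) + (d - t) \<le> pd q (pt a b t)"
    using pd_pt_le(4)[OF ab q t']
  proof (elim disjE exE conjE)
    assume "pd q (pt a b t) = pd q (Vx a) + t"
    then show ?thesis using pd_pt_le(1)[OF ab q c] by simp
  next
    assume "pd q (pt a b t) = pd q (Vx b) + (wl (a, b) - t)"
    then show ?thesis using pd_pt_le(2)[OF ab q d] by simp
  next
    fix x assume x: "q = Ed a b x" "pd q (pt a b t) = \<bar>x - t\<bar>"
    then have "x \<le> c \<or> d \<le> x" using off by force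
    then show ?thesis using pd_pt_le(3)[OF ab q c x(1)] pd_pt_le(3)[OF ab q d x(1)] x(2) t by linarith
  qed
  then show "min (pd q (pt a b c) + (t - c)) (pd q (pt a b d) + (d - t)) \<le> pd q (pt a b t)"
    by (simp add: min_le_iff_disj)
qed

text \<open>Only the direct route avoids both \<open>c\<close> and \<open>d\<close>; routes through
  \<open>a\<close> or \<open>b\<close> are again absorbed by the terms for the segment ends.\<close>

lemma pd_seg_on:
  assumes ab: "(a, b) \<in> E" and t: "0 \<le> c" "c \<le> t" "t \<le> d" "d \<le> wl (a, b)"
    and x: "c \<le> x" "x \<le> d"
  shows "pd (pt a b x) (pt a b t) = min (min (pd (pt a b x) (pt a b c) + (t - c))
      (pd (pt a b x) (pt a b d) + (d - t))) \<bar>t - x\<bar>"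
    and "pd (pt a b x) (pt a b c) \<le> x - c" and "pd (pt a b x) (pt a b d) \<le> d - x"
proof -
  have c: "0 \<le> c" "c \<le> wl (a, b)" and d: "0 \<le> d" "d \<le> wl (a, b)"
    and t': "0 \<le> t" "t \<le> wl (a, b)" and x': "0 \<le> x" "x \<le> wl (a, b)"
    using t x by auto
  let ?q = "pt a b x"
  have q: "?q \<in> P" by (rule pt_in[OF ab])
  note eq = pd_pt_pt[OF ab c x'] pd_pt_pt[OF ab d x'] pd_pt_pt[OF ab t' x']
  show "pd ?q (pt a b c) \<le> x - c" using eq(1) x by simp
  show "pd ?q (pt a b d) \<le> d - x" using eq(2) x by simp
  have "pd ?q (pt a b t) \<le> pd ?q (pt a b c) + (t - c)" "pd ?q (pt a b t) \<le> pd ?q (pt a b d) + (d - t)"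
    using pd_pt_lip[OF ab q t' c] pd_pt_lip[OF ab q t' d] t by auto
  moreover have "pd ?q (pt a b t) \<le> \<bar>t - x\<bar>" using eq(3) by simp
  moreover have "pd ?q (pt a b c) \<le> pd ?q (Vx a) + c" "pd ?q (pt a b d) \<le> pd ?q (Vx b) + (wl (a, b) - d)"
    using eq(1,2) by auto
  moreover have "pd ?q (pt a b t) = pd ?q (Vx a) + t \<or> pd ?q (pt a b t) = pd ?q (Vx b) + (wl (a, b) - t)
      \<or> pd ?q (pt a b t) = \<bar>t - x\<bar>"
    unfolding eq(3) by (auto simp: min_def)
  ultimately show "pd ?q (pt a b t) = min (min (pd ?q (pt a b c) + (t - c))
      (pd ?q (pt a b d) + (d - t))) \<bar>t - x\<bar>"
    by (smt (verit))
qed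

text \<open>As a minimum of affine functions of slopes 1 and -1 the distance is concave in
  \<open>x\<close>; the branch attaining the minimum at \<open>x0\<close> is an affine majorant
  touching there.\<close>

lemma pd_supergradient:
  assumes ab: "(a, b) \<in> E" and q: "q \<in> P" and x0: "0 \<le> \<alpha>" "\<alpha> < x0" "x0 < \<beta>" "\<beta> \<le> wl (a, b)"
    and off: "\<And>x. \<alpha> < x \<Longrightarrow> x < \<beta> \<Longrightarrow> q \<noteq> Ed a b x"
  shows "\<exists>\<sigma>. \<forall>x\<in>{\<alpha>..\<beta>}. pd q (pt a b x) \<le> pd q (pt a b x0) + \<sigma> * (x - x0)"
proof -
  have eq: "pd q (pt a b x) = min (pd q (pt a b \<alpha>) + (x - \<alpha>)) (pd q (pt a b \<beta>) + (\<beta> - x))"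
    if "x \<in> {\<alpha>..\<beta>}" for x
    by (rule pd_seg_off[OF ab q x0(1) _ _ x0(4)]) (use that off in auto)
  let ?g = "\<lambda>x. pd q (pt a b x)"
  have "x0 \<in> {\<alpha>..\<beta>}" using x0 by simp
  from eq[OF this] have "?g x0 = ?g \<alpha> + (x0 - \<alpha>) \<or> ?g x0 = ?g \<beta> + (\<beta> - x0)"
    by linarith
  then show ?thesis
  proof
    assume *: "?g x0 = ?g \<alpha> + (x0 - \<alpha>)"
    have "?g x \<le> ?g x0 + 1 * (x - x0)" if "x \<in> {\<alpha>..\<beta>}" for x
    proof -
      have "?g x \<le> ?g \<alpha> + (x - \<alpha>)" using eq[OF that] by linarith
      then show ?thesis unfolding * by simp
    qed
    then show ?thesis by blast
  next
    assume *: "?g x0 = ?g \<beta> + (\<beta> - x0)"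
    have "?g x \<le> ?g x0 + (- 1) * (x - x0)" if "x \<in> {\<alpha>..\<beta>}" for x
    proof -
      have "?g x \<le> ?g \<beta> + (\<beta> - x)" using eq[OF that] by linarith
      then show ?thesis unfolding * by simp
    qed
    then show ?thesis by blast
  qed
qed

lemma pd_pt_continuous:
  assumes "(a, b) \<in> E" "q \<in> P" "0 \<le> c" "d \<le> wl (a, b)"
  shows "continuous_on {c..d} (\<lambda>t. pd q (pt a b t))"
proof (rule lipschitz_on_continuous_on[of 1], rule lipschitz_onI)
  fix x y assume "x \<in> {c..d}" "y \<in> {c..d}"
  then show "dist (pd q (pt a b x)) (pd q (pt a b y)) \<le> 1 * dist x y"
    using pd_pt_lip[of a b q x y] pd_pt_lip[of a b q y x] assms by (auto simp: dist_real_def)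
qed simp

text \<open>Along the edge the distance follows one of three formulas of slope 1 or -1, leaving at
  most four coordinates for a given value \<open>r\<close>.\<close>

lemma finite_pd_level_edge:
  assumes ab: "(a, b) \<in> E" and q: "q \<in> P"
  shows "finite {t. 0 < t \<and> t < wl (a, b) \<and> pd q (Ed a b t) = r}"
proof -
  let ?T = "{t. 0 < t \<and> t < wl (a, b) \<and> pd q (Ed a b t) = r}"
  \<comment> \<open>If \<open>q\<close> does not lie inside this edge, \<open>x\<close> is arbitrary
    and merely adds two values to the finite bound.\<close>
  obtain x where x: "q = Ed a b x' \<Longrightarrow> x' = x" for x' by (cases q) auto
  have "?T \<subseteq> {r - pd q (Vx a), pd q (Vx b) + wl (a, b) - r, x - r, x + r}"
  proof
    fix t assume "t \<in> ?T"
    then have t: "0 \<le> t" "t \<le> wl (a, b)" "pd q (pt a b t) = r" by (auto simp: pt_open)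
    have "r = pd q (Vx a) + t \<or> r = pd q (Vx b) + (wl (a, b) - t) \<or> r = \<bar>x - t\<bar>"
      using pd_pt_le(4)[OF ab q t(1,2)] x unfolding t(3) by blast
    then show "t \<in> {r - pd q (Vx a), pd q (Vx b) + wl (a, b) - r, x - r, x + r}" by auto
  qed
  then show ?thesis by (rule finite_subset) simp
qed

lemma finite_pd_level:
  assumes q: "q \<in> P"
  shows "finite {p \<in> P. pd q p = r}"
proof (rule finite_subset)
  show "{p \<in> P. pd q p = r} \<subseteq> Vx ` V \<union>
    (\<Union>e\<in>E. Ed (fst e) (snd e) ` {t. 0 < t \<and> t < wl (fst e, snd e) \<and> pd q (Ed (fst e) (snd e) t) = r})"
  proof
    fix p assume p: "p \<in> {p \<in> P. pd q p = r}"
    show "p \<in> Vx ` V \<union>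
    (\<Union>e\<in>E. Ed (fst e) (snd e) ` {t. 0 < t \<and> t < wl (fst e, snd e) \<and> pd q (Ed (fst e) (snd e) t) = r})"
    proof (cases p)
      case (Ed a b t)
      then show ?thesis using p by (intro UnI2 UN_I[of "(a, b)"]) auto
    qed (use p in auto)
  qed
  show "finite (Vx ` V \<union>
    (\<Union>e\<in>E. Ed (fst e) (snd e) ` {t. 0 < t \<and> t < wl (fst e, snd e) \<and> pd q (Ed (fst e) (snd e) t) = r}))"
    using finV finE finite_pd_level_edge[OF _ q] by auto
qed

end

section \<open>Distance to the facilities of P1\<close>

locale facilities = metric_graph +
  fixes F :: "'a point set"
  assumes F_pts: "F \<subseteq> P" and finF: "finite F" and F_ne: "F \<noteq> {}"
begin

lemma sd_le: "f \<in> F \<Longrightarrow> sd p F \<le> pd p f"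
  unfolding dist_to_set_def using finF by auto

lemma sd_attained: "\<exists>f\<in>F. sd p F = pd p f"
proof -
  have "sd p F \<in> pd p ` F"
    unfolding dist_to_set_def by (rule Min_in) (use finF F_ne in auto)
  then show ?thesis by auto
qed

lemma sd_le': "f \<in> F \<Longrightarrow> sd p F \<le> pd f p"
  using sd_le[of f p] pdist_sym[of p f] by simp

lemma sd_pt_attained: "\<exists>f\<in>F. sd p F = pd f p"
  using sd_attained[of p] pdist_sym[of p] by auto

lemma sd_nonneg: "p \<in> P \<Longrightarrow> sd p F \<ge> 0"
  using sd_attained[of p] pdist_nonneg F_pts by fastforce

lemma sd_zero: "p \<in> F \<Longrightarrow> sd p F = 0"
  using sd_le[of p p] sd_nonneg[of p] F_pts pdist_refl[of p] by force

lemma sd_pos: "p \<in> P \<Longrightarrow> p \<notin> F \<Longrightarrow> sd p F > 0"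
  using sd_attained[of p] pdist_pos F_pts by (metis subsetD)

lemma sd_pt_lip:
  assumes "(a, b) \<in> E" "0 \<le> t" "t \<le> wl (a, b)" "0 \<le> t'" "t' \<le> wl (a, b)"
  shows "sd (pt a b t) F \<le> sd (pt a b t') F + \<bar>t - t'\<bar>"
proof -
  obtain f where f: "f \<in> F" "sd (pt a b t') F = pd f (pt a b t')" using sd_pt_attained by blast
  have "sd (pt a b t) F \<le> pd f (pt a b t)" using sd_le'[OF f(1)] by simp
  also have "\<dots> \<le> pd f (pt a b t') + \<bar>t - t'\<bar>" using pd_pt_lip assms f F_pts by blast
  finally show ?thesis using f by simp
qed

lemma sd_pt_continuous:
  assumes "(a, b) \<in> E" "0 \<le> c" "d \<le> wl (a, b)"
  shows "continuous_on {c..d} (\<lambda>t. sd (pt a b t) F)"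
proof (rule lipschitz_on_continuous_on[of 1], rule lipschitz_onI)
  fix x y assume "x \<in> {c..d}" "y \<in> {c..d}"
  then show "dist (sd (pt a b x) F) (sd (pt a b y) F) \<le> 1 * dist x y"
    using sd_pt_lip[of a b x y] sd_pt_lip[of a b y x] assms by (auto simp: dist_real_def)
qed simp

text \<open>The facility nearest to \<open>t\<close> is not strictly inside the segment, so its
  route passes \<open>c\<close> or \<open>d\<close>; the Lipschitz property gives the other
  inequality.\<close>

lemma sd_seg:
  assumes ab: "(a, b) \<in> E" and t: "0 \<le> c" "c \<le> t" "t \<le> d" "d \<le> wl (a, b)"
    and off: "\<And>x. c < x \<Longrightarrow> x < d \<Longrightarrow> Ed a b x \<notin> F"
  shows "sd (pt a b t) F = min (sd (pt a b c) F + (t - c)) (sd (pt a b d) F + (d - t))"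
proof -
  obtain f where f: "f \<in> F" "sd (pt a b t) F = pd f (pt a b t)" using sd_pt_attained by blast
  have "pd f (pt a b t) = min (pd f (pt a b c) + (t - c)) (pd f (pt a b d) + (d - t))"
    using pd_seg_off[OF ab _ t] f off F_pts by blast
  moreover have "sd (pt a b c) F \<le> pd f (pt a b c)" "sd (pt a b d) F \<le> pd f (pt a b d)"
    using sd_le'[OF f(1)] by simp_all
  moreover have "sd (pt a b t) F \<le> sd (pt a b c) F + (t - c)" "sd (pt a b t) F \<le> sd (pt a b d) F + (d - t)"
    using sd_pt_lip[OF ab, of t c] sd_pt_lip[OF ab, of t d] t by auto
  ultimately show ?thesis using f by linarith
qed

end

section \<open>Served lengths and the payoff\<close>

context facilities
begin

lemma served_iff: "served E wl F S p \<longleftrightarrow> (\<exists>s\<in>S. pd s p \<le> sd p F)"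
  unfolding served_def using pdist_sym[of p] by simp

text \<open>Both distances are continuous along the edge, so the served part is the open interval
  intersected with a finite union of closed sets.\<close>

lemma served_sets:
  assumes ab: "(a, b) \<in> E" and S: "finite S" "S \<subseteq> P" and cd: "0 \<le> c" "d \<le> wl (a, b)"
  shows "{t \<in> {c<..<d}. served E wl F S (Ed a b t)} \<in> sets borel"
proof -
  have "{t \<in> {c<..<d}. served E wl F S (Ed a b t)}
    = {c<..<d} \<inter> (\<Union>s\<in>S. {t \<in> {c..d}. pd s (pt a b t) \<le> sd (pt a b t) F})"
    using cd by (auto simp: served_iff pt_open)
  moreover have "closed {t \<in> {c..d}. pd s (pt a b t) \<le> sd (pt a b t) F}" if "s \<in> S" for s
    using that S cd ab
    by (intro continuous_on_closed_Collect_le pd_pt_continuous sd_pt_continuous) auto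
  then have "closed (\<Union>s\<in>S. {t \<in> {c..d}. pd s (pt a b t) \<le> sd (pt a b t) F})"
    using S by (intro closed_UN) auto
  ultimately show ?thesis by (simp add: borel_closed sets.Int)
qed

definition served_len :: "'a \<Rightarrow> 'a \<Rightarrow> real \<Rightarrow> real \<Rightarrow> 'a point set \<Rightarrow> real" where
  "served_len a b c d S = measure lborel {t \<in> {c<..<d}. served E wl F S (Ed a b t)}"

lemma served_fmeasurable:
  assumes "(a, b) \<in> E" "finite S" "S \<subseteq> P" "0 \<le> c" "d \<le> wl (a, b)"
  shows "{t \<in> {c<..<d}. served E wl F S (Ed a b t)} \<in> fmeasurable lborel"
proof (rule fmeasurableI2)
  show "{c<..<d} \<in> fmeasurable lborel" by (cases "c \<le> d") (auto intro: fmeasurableI)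
qed (use served_sets[OF assms] in auto)

text \<open>The cut point \<open>m\<close> is a null set.\<close>

lemma served_len_split:
  assumes "(a, b) \<in> E" "finite S" "S \<subseteq> P" "0 \<le> c" "c < m" "m < d" "d \<le> wl (a, b)"
  shows "served_len a b c d S = served_len a b c m S + served_len a b m d S"
proof -
  let ?A = "\<lambda>c d. {t \<in> {c<..<d}. served E wl F S (Ed a b t)}"
  have f1: "?A c m \<in> fmeasurable lborel" and f2: "?A m d \<in> fmeasurable lborel"
    and f: "?A c d \<in> fmeasurable lborel"
    by (rule served_fmeasurable; use assms in linarith)+
  have "measure lborel (?A c m \<union> ?A m d) = served_len a b c m S + served_len a b m d S"
    unfolding served_len_def using f1 f2 by (intro measure_Union) (auto simp: fmeasurable_def)
  moreover have "measure lborel (?A c d) = measure lborel (?A c m \<union> ?A m d)"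
  proof (rule measure_eq_AE)
    have "AE t in lborel. t \<noteq> m" by (rule AE_lborel_singleton)
    then show "AE t in lborel. t \<in> ?A c d \<longleftrightarrow> t \<in> ?A c m \<union> ?A m d"
      by eventually_elim (use assms in auto)
  qed (intro fmeasurableD fmeasurable.Un f f1 f2)+
  ultimately show ?thesis by (simp add: served_len_def)
qed

lemma served_mono: "S \<subseteq> S' \<Longrightarrow> served E wl F S p \<Longrightarrow> served E wl F S' p"
  unfolding served_def by blast

lemma served_len_mono:
  assumes "(a, b) \<in> E" "finite S'" "S' \<subseteq> P" "S \<subseteq> S'"
  shows "served_len a b 0 (wl (a, b)) S \<le> served_len a b 0 (wl (a, b)) S'"
  unfolding served_len_def
proof (rule measure_mono_fmeasurable)
  show "{t \<in> {0<..<wl (a, b)}. served E wl F S (Ed a b t)} \<in> sets lborel"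
    using served_sets[OF assms(1), of S 0 "wl (a, b)"] assms(2-4) finite_subset by auto
  show "{t \<in> {0<..<wl (a, b)}. served E wl F S' (Ed a b t)} \<in> fmeasurable lborel"
    using served_fmeasurable assms by auto
qed (use assms served_mono in blast)

lemma served_len_le:
  assumes "(a, b) \<in> E" "finite S" "S \<subseteq> P"
  shows "served_len a b 0 (wl (a, b)) S \<le> wl (a, b)"
proof -
  have pos: "0 \<le> wl (a, b)" using edgeD[OF assms(1)] by simp
  have "served_len a b 0 (wl (a, b)) S \<le> wl (a, b) - 0"
    unfolding served_len_def using pos served_sets[OF assms, of 0 "wl (a, b)"]
    by (intro measure_le_interval) auto
  then show ?thesis by simp
qed

lemma Q2_eq: "Q2 V E wv wl F S = (\<Sum>v\<in>V. if served E wl F S (Vx v) then wv v else 0)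
   + (\<Sum>e\<in>E. served_len (fst e) (snd e) 0 (wl e) S)"
  by (simp add: Q2_def served_len_def)

text \<open>Extra servers never hurt, which allows a placement with fewer than \<open>k\<close>
  points to be filled up.\<close>

lemma Q2_mono:
  assumes "finite S'" "S' \<subseteq> P" "S \<subseteq> S'" "\<forall>v\<in>V. wv v \<ge> 0"
  shows "Q2 V E wv wl F S \<le> Q2 V E wv wl F S'"
  unfolding Q2_eq
proof (intro add_mono sum_mono)
  fix v assume "v \<in> V"
  then show "(if served E wl F S (Vx v) then wv v else 0) \<le> (if served E wl F S' (Vx v) then wv v else 0)"
    using assms served_mono[OF assms(3)] by auto
next
  fix e assume "e \<in> E"
  then show "served_len (fst e) (snd e) 0 (wl e) S \<le> served_len (fst e) (snd e) 0 (wl e) S'"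
    using served_len_mono[of "fst e" "snd e" S' S] assms by simp
qed

text \<open>Makes the set of payoffs bounded above, so that the \<open>Sup\<close> in
  \<open>eta\<close> is a genuine supremum.\<close>

lemma Q2_bound:
  assumes "finite S" "S \<subseteq> P" "\<forall>v\<in>V. wv v \<ge> 0"
  shows "Q2 V E wv wl F S \<le> sum wv V + sum wl E"
  unfolding Q2_eq
proof (intro add_mono sum_mono)
  fix e assume "e \<in> E"
  then show "served_len (fst e) (snd e) 0 (wl e) S \<le> wl e"
    using served_len_le[of "fst e" "snd e" S] assms by simp
qed (use assms in auto)

end

section \<open>Sliding one point of a placement\<close>

text \<open>Only the open range is restricted: its ends, where the sliding point stops, may lie on
  the level of some vertex.\<close>

locale edge_move = facilities +
  fixes S :: "'a point set" and a b :: 'a and \<alpha> \<beta> x0 :: real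
  assumes finS: "finite S" and S_pts: "S \<subseteq> P" and x0S: "Ed a b x0 \<in> S"
    and ab: "(a, b) \<in> E" and range: "0 \<le> \<alpha>" "\<alpha> < x0" "x0 < \<beta>" "\<beta> \<le> wl (a, b)"
    and noF: "\<And>x. \<alpha> < x \<Longrightarrow> x < \<beta> \<Longrightarrow> Ed a b x \<notin> F"
    and noV: "\<And>v x. v \<in> V \<Longrightarrow> \<alpha> < x \<Longrightarrow> x < \<beta> \<Longrightarrow> pd (Vx v) (Ed a b x) \<noteq> sd (Vx v) F"
begin

definition mv :: "real \<Rightarrow> 'a point \<Rightarrow> 'a point" where
  "mv x s = (if s = Ed a b x0 then pt a b x else s)"

lemma mv_x0: "mv x0 s = s"
  using range by (simp add: mv_def pt_open)

lemma mv_in: "s \<in> S \<Longrightarrow> mv x s \<in> P"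
  using S_pts pt_in[OF ab] by (auto simp: mv_def)

lemma mv_image: "finite (mv x ` S)" "mv x ` S \<subseteq> P"
  using finS mv_in by auto

text \<open>A facility has level 0, which no point outside \<open>F\<close> attains. Facilities used
  as cut points therefore behave like vertices.\<close>

lemma level_avoided:
  assumes q: "q \<in> Vx ` V \<union> F" and x: "\<alpha> < x" "x < \<beta>"
  shows "pd q (pt a b x) - sd q F \<noteq> 0"
proof (cases "q \<in> F")
  case True
  have "pt a b x = Ed a b x" "Ed a b x \<notin> F" "Ed a b x \<in> P"
    using x range ab noF by (auto simp: pt_open)
  then have "pd q (pt a b x) > 0" using True F_pts pdist_pos[of q "Ed a b x"] by auto
  then show ?thesis using sd_zero[OF True] by simp
next
  case False
  then show ?thesis using q x range noV by (auto simp: pt_open)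
qed

text \<open>\<open>sign_persists\<close> applied to distance minus level, with ties possible at the
  ends of the range. This supplies the four assumptions of \<open>segment_servers\<close> on the
  sides held by the ends.\<close>

lemma status_persists:
  assumes q: "q \<in> Vx ` V \<union> F" and s: "s \<in> S" and x: "x \<in> {\<alpha>..\<beta>}"
  shows "pd q (mv x0 s) \<le> sd q F \<Longrightarrow> pd q (mv x s) \<le> sd q F"
    and "pd q (mv x0 s) > sd q F \<Longrightarrow> pd q (mv x s) \<ge> sd q F"
proof -
  have qP: "q \<in> P" using q F_pts by auto
  have cont: "continuous_on {\<alpha>..\<beta>} (\<lambda>x. pd q (pt a b x))"
    using pd_pt_continuous[OF ab qP] range by simp
  have ne: "pd q (pt a b x0) - sd q F \<noteq> 0" using level_avoided[OF q] range by simp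
  show "pd q (mv x s) \<le> sd q F" if "pd q (mv x0 s) \<le> sd q F"
  proof (cases "s = Ed a b x0")
    case True
    have "0 \<le> sd q F - pd q (pt a b x)"
    proof (rule sign_persists[OF _ range(2,3) _ _ x])
      show "continuous_on {\<alpha>..\<beta>} (\<lambda>x. sd q F - pd q (pt a b x))" by (intro continuous_intros cont)
      show "sd q F - pd q (pt a b z) \<noteq> 0" if "\<alpha> < z" "z < \<beta>" for z
        using level_avoided[OF q that] by linarith
      show "0 < sd q F - pd q (pt a b x0)" using that ne True by (simp add: mv_def)
    qed
    then show ?thesis using True by (simp add: mv_def)
  qed (use that in \<open>simp add: mv_def\<close>)
  show "pd q (mv x s) \<ge> sd q F" if "pd q (mv x0 s) > sd q F"
  proof (cases "s = Ed a b x0")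
    case True
    have "0 \<le> pd q (pt a b x) - sd q F"
    proof (rule sign_persists[OF _ range(2,3) level_avoided[OF q] _ x])
      show "continuous_on {\<alpha>..\<beta>} (\<lambda>x. pd q (pt a b x) - sd q F)" by (intro continuous_intros cont)
      show "0 < pd q (pt a b x0) - sd q F" using that True by (simp add: mv_def)
    qed
    then show ?thesis using True by (simp add: mv_def)
  qed (use that in \<open>simp add: mv_def\<close>)
qed

lemma mv_supergradient:
  assumes q: "q \<in> Vx ` V \<union> F" and s: "s \<in> S"
  shows "\<exists>\<sigma>. \<forall>x\<in>{\<alpha>..\<beta>}. pd q (mv x s) \<le> pd q (mv x0 s) + \<sigma> * (x - x0)"
proof (cases "s = Ed a b x0")
  case True
  have "q \<in> P" using q F_pts by auto
  then have "\<exists>\<sigma>. \<forall>x\<in>{\<alpha>..\<beta>}. pd q (pt a b x) \<le> pd q (pt a b x0) + \<sigma> * (x - x0)"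
    by (rule pd_supergradient[OF ab _ range]) (use q noF in auto)
  then show ?thesis using True by (simp add: mv_def)
next
  case False
  then show ?thesis by (intro exI[of _ 0]) (simp add: mv_def)
qed

text \<open>Facilities are excluded from the open range and vertices are not interior points of an
  edge, so the sliding point never crosses a cut point.\<close>

lemma breakpoint_avoids:
  assumes "(a, b) = (a', b')" "pt a' b' c \<in> Vx ` V \<union> F"
  shows "c \<le> \<alpha> \<or> \<beta> \<le> c"
proof (rule ccontr)
  assume "\<not> (c \<le> \<alpha> \<or> \<beta> \<le> c)"
  then have "\<alpha> < c" "c < \<beta>" by auto
  then show False using noF[of c] range assms by (auto simp: pt_open)
qed

lemma segment_subgradient:
  assumes e: "(a', b') \<in> E" and cd: "0 \<le> c" "c < d" "d \<le> wl (a', b')"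
    and c: "pt a' b' c \<in> Vx ` V \<union> F" and d: "pt a' b' d \<in> Vx ` V \<union> F"
    and noF': "\<And>x. c < x \<Longrightarrow> x < d \<Longrightarrow> Ed a' b' x \<notin> F"
  shows "\<exists>\<sigma>. \<forall>x\<in>{\<alpha>..\<beta>}.
    served_len a' b' c d S + \<sigma> * (x - x0) \<le> served_len a' b' c d (mv x ` S)"
proof -
  \<comment> \<open>\<open>on\<close> refers to the position before sliding. A sliding point that
    starts inside stays in the closed piece (\<open>on_y\<close>); one that starts elsewhere never
    enters the interior (\<open>off_y\<close>).\<close>
  define on where "on s \<longleftrightarrow> (\<exists>y. s = Ed a' b' y \<and> c < y \<and> y < d)" for s
  \<comment> \<open>The sliding point has the variable coordinate \<open>x\<close>, the others keep
    theirs; vertices, which are never \<open>on\<close>, get the default 0.\<close>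
  define y where "y s x = (if s = Ed a b x0 then x else (case s of Ed _ _ t \<Rightarrow> t | _ \<Rightarrow> 0))" for s x
  let ?c = "pt a' b' c" and ?d = "pt a' b' d" and ?I = "{\<alpha>..\<beta>}"
  have on_y: "mv x s = pt a' b' (y s x) \<and> c \<le> y s x \<and> y s x \<le> d"
    if s: "s \<in> S" "on s" and x: "x \<in> ?I" for s x
  proof (cases "s = Ed a b x0")
    case True
    with s have eq: "(a, b) = (a', b')" "c < x0" "x0 < d" by (auto simp: on_def)
    then have "c \<le> \<alpha>" "\<beta> \<le> d"
      using breakpoint_avoids[OF eq(1) c] breakpoint_avoids[OF eq(1) d] range by auto
    moreover have "mv x s = pt a b x" "y s x = x" using True by (simp_all add: mv_def y_def)
    ultimately show ?thesis using eq(1) x by simp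
  next
    case False
    then show ?thesis using s cd by (auto simp: on_def mv_def y_def pt_open)
  qed
  have off_y: "mv x s \<noteq> Ed a' b' z" if s: "s \<in> S" "\<not> on s" and x: "x \<in> ?I" and z: "c < z" "z < d" for s x z
  proof (cases "s = Ed a b x0")
    case True
    show ?thesis
    proof
      assume "mv x s = Ed a' b' z"
      then have eq: "(a, b) = (a', b')" "z = x" using True by (auto simp: mv_def pt_eq_Ed)
      then have "x0 \<le> c \<or> d \<le> x0" using s(2) True by (auto simp: on_def)
      then show False
        using breakpoint_avoids[OF eq(1) c] breakpoint_avoids[OF eq(1) d] range z x eq(2) by auto
    qed
  next
    case False
    then show ?thesis using s z by (auto simp: on_def mv_def)
  qed
  have cdP: "?c \<in> P" "?d \<in> P" by (rule pt_in[OF e])+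
  have cd': "0 \<le> c" "c \<le> wl (a', b')" "0 \<le> d" "d \<le> wl (a', b')" using cd by auto
  interpret seg: segment_servers c d "sd ?c F" "sd ?d F" x0 ?I S
    "\<lambda>s x. pd ?c (mv x s)" "\<lambda>s x. pd ?d (mv x s)" y on
  proof
    show "sd ?c F \<ge> 0" "sd ?d F \<ge> 0" by (rule sd_nonneg; rule cdP)+
    show "\<bar>sd ?c F - sd ?d F\<bar> \<le> d - c"
      using sd_pt_lip[OF e cd'] sd_pt_lip[OF e cd'(3,4,1,2)] cd by auto
    show "\<bar>pd ?c (mv x s) - pd ?d (mv x s)\<bar> \<le> d - c" if "s \<in> S" "x \<in> ?I" for s x
      using pd_pt_lip[OF e mv_in[OF that(1)] cd', of x] pd_pt_lip[OF e mv_in[OF that(1)] cd'(3,4,1,2), of x] cd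
        pdist_sym[of "mv x s" ?c] pdist_sym[of "mv x s" ?d] by auto
    show "\<exists>\<tau>. \<forall>x\<in>?I. y s x = y s x0 + \<tau> * (x - x0)" if "s \<in> S" "on s" for s
      by (cases "s = Ed a b x0") (auto simp: y_def intro: exI[of _ 1] exI[of _ 0])
    show "c \<le> y s x \<and> y s x \<le> d" if "s \<in> S" "on s" "x \<in> ?I" for s x
      using on_y[OF that] by simp
    show "pd ?c (mv x s) \<le> y s x - c" "pd ?d (mv x s) \<le> d - y s x"
      if "s \<in> S" "on s" "x \<in> ?I" for s x
      using on_y[OF that] pd_seg_on(2,3)[OF e cd(1) _ _ cd(3), of c "y s x"] cd
        pdist_sym[of "mv x s" ?c] pdist_sym[of "mv x s" ?d] by auto
  qed (use cd finS range mv_supergradient[OF c] mv_supergradient[OF d]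
        status_persists[OF c] status_persists[OF d] in auto)
  have R: "{t \<in> {c<..<d}. served E wl F (mv x ` S) (Ed a' b' t)} = seg.R x" if x: "x \<in> ?I" for x
  proof -
    have "served E wl F (mv x ` S) (Ed a' b' t) \<longleftrightarrow> (\<exists>s\<in>S.
       min (pd ?c (mv x s) + (t - c)) (pd ?d (mv x s) + (d - t)) \<le> min (sd ?c F + (t - c)) (sd ?d F + (d - t))
       \<or> on s \<and> \<bar>t - y s x\<bar> \<le> min (sd ?c F + (t - c)) (sd ?d F + (d - t)))"
      if t: "c < t" "t < d" for t
    proof -
      have t': "c \<le> t" "t \<le> d" using t by auto
      have pt: "pt a' b' t = Ed a' b' t" using t cd by (simp add: pt_open)
      have F: "sd (Ed a' b' t) F = min (sd ?c F + (t - c)) (sd ?d F + (d - t))"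
        using sd_seg[OF e cd(1) t' cd(3) noF'] pt by simp
      have "pd (mv x s) (Ed a' b' t) \<le> r \<longleftrightarrow>
         min (pd ?c (mv x s) + (t - c)) (pd ?d (mv x s) + (d - t)) \<le> r \<or> on s \<and> \<bar>t - y s x\<bar> \<le> r"
        if s: "s \<in> S" for s r
      proof (cases "on s")
        case True
        have "pd (mv x s) (Ed a' b' t) =
          min (min (pd ?c (mv x s) + (t - c)) (pd ?d (mv x s) + (d - t))) \<bar>t - y s x\<bar>"
          using pd_seg_on(1)[OF e cd(1) t' cd(3), of "y s x"] on_y[OF s True x]
            pdist_sym[of "mv x s" ?c] pdist_sym[of "mv x s" ?d] pt by auto
        then show ?thesis using True by (simp only: min_le_iff_disj simp_thms)
      next
        case False
        have "pd (mv x s) (Ed a' b' t) = min (pd ?c (mv x s) + (t - c)) (pd ?d (mv x s) + (d - t))"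
          using pd_seg_off[OF e mv_in[OF s] cd(1) t' cd(3) off_y[OF s False x]]
            pdist_sym[of "mv x s" ?c] pdist_sym[of "mv x s" ?d] pt by simp
        then show ?thesis using False by simp
      qed
      then show ?thesis unfolding served_iff F by blast
    qed
    then show ?thesis unfolding seg_region_def by auto
  qed
  have "mv x0 ` S = S" using mv_x0 by simp
  then have R0: "{t \<in> {c<..<d}. served E wl F S (Ed a' b' t)} = seg.R x0"
    using R[of x0] range by simp
  obtain \<sigma> where "\<forall>x\<in>?I. measure lborel (seg.R x0) + \<sigma> * (x - x0) \<le> measure lborel (seg.R x)"
    using seg.subgradient by blast
  then have "\<forall>x\<in>?I. served_len a' b' c d S + \<sigma> * (x - x0) \<le> served_len a' b' c d (mv x ` S)"
    unfolding served_len_def using R R0 by simp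
  then show ?thesis by blast
qed

text \<open>Induction on the number of facilities strictly between \<open>c\<close> and
  \<open>d\<close>: cut at one of them and add the slopes of the two sides.\<close>

lemma subedge_subgradient:
  assumes e: "(a', b') \<in> E" and "0 \<le> c" "c < d" "d \<le> wl (a', b')"
    and "pt a' b' c \<in> Vx ` V \<union> F" and "pt a' b' d \<in> Vx ` V \<union> F"
  shows "\<exists>\<sigma>. \<forall>x\<in>{\<alpha>..\<beta>}.
    served_len a' b' c d S + \<sigma> * (x - x0) \<le> served_len a' b' c d (mv x ` S)"
  using assms(2-)
proof (induction "card {t. c < t \<and> t < d \<and> Ed a' b' t \<in> F}" arbitrary: c d rule: less_induct)
  case less
  let ?B = "\<lambda>c d. {t. c < t \<and> t < d \<and> Ed a' b' t \<in> F}"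
  have fin: "finite (?B c d)"
  proof (rule finite_subset)
    show "?B c d \<subseteq> (\<lambda>p. case p of Ed _ _ t \<Rightarrow> t | _ \<Rightarrow> 0) ` F"
      by (auto intro!: rev_image_eqI)
    show "finite ((\<lambda>p. case p of Ed _ _ t \<Rightarrow> t | _ \<Rightarrow> 0) ` F)" using finF by simp
  qed
  show ?case
  proof (cases "?B c d = {}")
    case True
    then show ?thesis using segment_subgradient[OF e less.prems] by blast
  next
    case False
    then obtain m where m: "c < m" "m < d" "Ed a' b' m \<in> F" by blast
    have lt: "card (?B c m) < card (?B c d)" "card (?B m d) < card (?B c d)"
      using m by (intro psubset_card_mono[OF fin]; force)+
    have "pt a' b' m \<in> Vx ` V \<union> F" using m less.prems by (simp add: pt_open)
    then obtain \<sigma>1 \<sigma>2 where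
      1: "\<forall>x\<in>{\<alpha>..\<beta>}. served_len a' b' c m S + \<sigma>1 * (x - x0) \<le> served_len a' b' c m (mv x ` S)" and
      2: "\<forall>x\<in>{\<alpha>..\<beta>}. served_len a' b' m d S + \<sigma>2 * (x - x0) \<le> served_len a' b' m d (mv x ` S)"
      using less.hyps[OF lt(1)] less.hyps[OF lt(2)] less.prems m by (meson less_eq_real_def order_trans)
    have split: "served_len a' b' c d T = served_len a' b' c m T + served_len a' b' m d T"
      if "finite T" "T \<subseteq> P" for T
      using served_len_split[OF e that less.prems(1) m(1,2) less.prems(3)] .
    have "\<forall>x\<in>{\<alpha>..\<beta>}. served_len a' b' c d S + (\<sigma>1 + \<sigma>2) * (x - x0) \<le> served_len a' b' c d (mv x ` S)"
      using 1 2 unfolding split[OF finS S_pts] split[OF mv_image] by (fastforce simp: algebra_simps)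
    then show ?thesis by blast
  qed
qed

text \<open>No served vertex is lost during the slide, so the vertex sum does not drop, and the
  slopes of the edges add up.\<close>

lemma Q2_subgradient:
  assumes wv: "\<forall>v\<in>V. wv v \<ge> 0"
  shows "\<exists>\<sigma>. \<forall>x\<in>{\<alpha>..\<beta>}. Q2 V E wv wl F S + \<sigma> * (x - x0) \<le> Q2 V E wv wl F (mv x ` S)"
proof -
  have "\<forall>e\<in>E. \<exists>\<sigma>. \<forall>x\<in>{\<alpha>..\<beta>}. served_len (fst e) (snd e) 0 (wl e) S + \<sigma> * (x - x0)
      \<le> served_len (fst e) (snd e) 0 (wl e) (mv x ` S)"
  proof
    fix e assume "e \<in> E"
    then have e: "(fst e, snd e) \<in> E" by simp
    show "\<exists>\<sigma>. \<forall>x\<in>{\<alpha>..\<beta>}. served_len (fst e) (snd e) 0 (wl e) S + \<sigma> * (x - x0)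
      \<le> served_len (fst e) (snd e) 0 (wl e) (mv x ` S)"
      using subedge_subgradient[OF e, of 0 "wl e"] edgeD[OF e] pt_wl[OF e] by (simp add: pt_0)
  qed
  then obtain \<sigma> where \<sigma>: "\<And>e x. e \<in> E \<Longrightarrow> x \<in> {\<alpha>..\<beta>} \<Longrightarrow>
      served_len (fst e) (snd e) 0 (wl e) S + \<sigma> e * (x - x0)
      \<le> served_len (fst e) (snd e) 0 (wl e) (mv x ` S)" by metis
  have "Q2 V E wv wl F S + sum \<sigma> E * (x - x0) \<le> Q2 V E wv wl F (mv x ` S)" if x: "x \<in> {\<alpha>..\<beta>}" for x
  proof -
    have "served E wl F (mv x ` S) (Vx v)" if v: "v \<in> V" and srv: "served E wl F S (Vx v)" for v
    proof -
      obtain s where "s \<in> S" "pd (Vx v) s \<le> sd (Vx v) F" using srv by (auto simp: served_def)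
      then have "pd (Vx v) (mv x s) \<le> sd (Vx v) F" "s \<in> S"
        using status_persists(1)[of "Vx v" s x] v x mv_x0 by auto
      then show ?thesis by (auto simp: served_def)
    qed
    then have "(\<Sum>v\<in>V. if served E wl F S (Vx v) then wv v else 0)
      \<le> (\<Sum>v\<in>V. if served E wl F (mv x ` S) (Vx v) then wv v else 0)"
      using wv by (intro sum_mono) auto
    moreover have "(\<Sum>e\<in>E. served_len (fst e) (snd e) 0 (wl e) S) + sum \<sigma> E * (x - x0)
      \<le> (\<Sum>e\<in>E. served_len (fst e) (snd e) 0 (wl e) (mv x ` S))"
      unfolding sum_distrib_right sum.distrib[symmetric] using \<sigma> x by (intro sum_mono) auto
    ultimately show ?thesis unfolding Q2_eq by linarith
  qed
  then show ?thesis by blast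
qed

text \<open>The sign of the slope tells which end to slide to.\<close>

lemma Q2_endpoint:
  assumes wv: "\<forall>v\<in>V. wv v \<ge> 0"
  shows "\<exists>x\<in>{\<alpha>, \<beta>}. Q2 V E wv wl F S \<le> Q2 V E wv wl F (mv x ` S)"
proof -
  obtain \<sigma> where \<sigma>: "\<And>x. x \<in> {\<alpha>..\<beta>} \<Longrightarrow>
      Q2 V E wv wl F S + \<sigma> * (x - x0) \<le> Q2 V E wv wl F (mv x ` S)"
    using Q2_subgradient[OF wv] by blast
  show ?thesis
  proof (cases "\<sigma> \<ge> 0")
    case True
    then have "\<sigma> * (\<beta> - x0) \<ge> 0" using range by simp
    then show ?thesis using \<sigma>[of \<beta>] range by force
  next
    case False
    then have "\<sigma> * (\<alpha> - x0) \<ge> 0" using range by (simp add: mult_nonpos_nonpos)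
    then show ?thesis using \<sigma>[of \<alpha>] range by force
  qed
qed

end

section \<open>Candidate placements\<close>

context facilities
begin

text \<open>This is \<open>C_\<epsilon>\<close>: the three sets united are \<Gamma>_0, the vertices
  and \<open>N_\<epsilon>\<close>.\<close>

definition cand :: "('a \<Rightarrow> 'a point) \<Rightarrow> real \<Rightarrow> 'a point set" where
  "cand f \<epsilon> = ((\<Union>v\<in>V. {p \<in> P. p \<noteq> f v \<and> pd (Vx v) p = sd (Vx v) F}) \<union> Vx ` V
     \<union> {p \<in> P. sd p F = \<epsilon>}) - F"

lemma cand_subset: "cand f \<epsilon> \<subseteq> P" "cand f \<epsilon> \<inter> F = {}"
  by (auto simp: cand_def)

text \<open>A level of \<open>sd\<close> is covered by levels of finitely many single distances.
  Finiteness makes \<open>Max\<close> meaningful and provides neighbouring candidates on an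
  edge.\<close>

lemma finite_cand: "finite (cand f \<epsilon>)"
proof -
  have "{p \<in> P. sd p F = \<epsilon>} \<subseteq> (\<Union>q\<in>F. {p \<in> P. pd q p = \<epsilon>})"
  proof
    fix p assume "p \<in> {p \<in> P. sd p F = \<epsilon>}"
    then show "p \<in> (\<Union>q\<in>F. {p \<in> P. pd q p = \<epsilon>})" using sd_pt_attained[of p] by auto
  qed
  moreover have "finite (\<Union>q\<in>F. {p \<in> P. pd q p = \<epsilon>})"
    using finF F_pts finite_pd_level by auto
  ultimately have "finite {p \<in> P. sd p F = \<epsilon>}" by (rule finite_subset)
  moreover have "finite {p \<in> P. p \<noteq> f v \<and> pd (Vx v) p = sd (Vx v) F}" if "v \<in> V" for v
    by (rule finite_subset[OF _ finite_pd_level[of "Vx v" "sd (Vx v) F"]]) (use that in auto)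
  ultimately show ?thesis using finV by (auto simp: cand_def)
qed

text \<open>The bound \<open>sd q F \<ge> \<epsilon>\<close> is passed on so that the next point can
  be moved with the same \<open>\<epsilon>\<close>; it also keeps \<open>q\<close> out of
  \<open>F\<close>.\<close>

lemma move_to_cand:
  assumes wv: "\<forall>v\<in>V. wv v \<ge> 0" and f: "\<forall>v\<in>V. f v \<in> F" and \<epsilon>: "\<epsilon> > 0"
    and S: "finite S" "S \<subseteq> P" and far: "\<forall>p\<in>S. sd p F \<ge> \<epsilon>"
    and p: "p \<in> S" "p \<notin> cand f \<epsilon>"
  shows "\<exists>q\<in>cand f \<epsilon>. sd q F \<ge> \<epsilon> \<and> Q2 V E wv wl F S \<le> Q2 V E wv wl F (insert q (S - {p}))"
proof -
  have notF: "q \<notin> F" if "sd q F \<ge> \<epsilon>" for q using sd_zero that \<epsilon> by force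
  have pF: "p \<notin> F" using notF far p by blast
  then obtain a b x0 where px: "p = Ed a b x0" using p S by (cases p) (auto simp: cand_def)
  have ab: "(a, b) \<in> E" and x0: "0 < x0" "x0 < wl (a, b)" using px p S by auto
  \<comment> \<open>The ends of the edge are included so that a stopping place exists on both sides
    of \<open>x0\<close>.\<close>
  define Z where "Z = {0, wl (a, b)} \<union> {t. Ed a b t \<in> cand f \<epsilon>}"
  have "finite {t. Ed a b t \<in> cand f \<epsilon>}"
    using finite_vimageI[OF finite_cand, of "Ed a b"] by (simp add: vimage_def inj_def)
  then have finZ: "finite Z" by (simp add: Z_def)
  define \<alpha> where "\<alpha> = Max {z \<in> Z. z < x0}"
  define \<beta> where "\<beta> = Min {z \<in> Z. z > x0}"
  have lo: "finite {z \<in> Z. z < x0}" "0 \<in> {z \<in> Z. z < x0}"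
    and hi: "finite {z \<in> Z. z > x0}" "wl (a, b) \<in> {z \<in> Z. z > x0}"
    using finZ x0 by (auto simp: Z_def)
  have \<alpha>: "\<alpha> \<in> Z" "\<alpha> < x0" "0 \<le> \<alpha>" "\<And>z. z \<in> Z \<Longrightarrow> z < x0 \<Longrightarrow> z \<le> \<alpha>"
    using Max_in[OF lo(1)] Max_ge[OF lo(1)] lo(2) by (auto simp: \<alpha>_def)
  have \<beta>: "\<beta> \<in> Z" "x0 < \<beta>" "\<beta> \<le> wl (a, b)" "\<And>z. z \<in> Z \<Longrightarrow> x0 < z \<Longrightarrow> \<beta> \<le> z"
    using Min_in[OF hi(1)] Min_le[OF hi(1)] hi(2) by (auto simp: \<beta>_def)
  have gap: "Ed a b x \<notin> cand f \<epsilon>" if x: "\<alpha> < x" "x < \<beta>" for x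
  proof (cases "x = x0")
    case True
    then show ?thesis using p px by simp
  next
    case False
    then have "x \<notin> Z" using \<alpha>(4)[of x] \<beta>(4)[of x] x by force
    then show ?thesis by (simp add: Z_def)
  qed
  have inP: "Ed a b x \<in> P" if "\<alpha> < x" "x < \<beta>" for x using that \<alpha> \<beta> ab by simp
  have eps: "sd (pt a b x) F \<ge> \<epsilon>" if x: "x \<in> {\<alpha>..\<beta>}" for x
  proof -
    \<comment> \<open>A point at distance exactly \<open>\<epsilon>\<close> from \<open>F\<close>
      would be a candidate in the gap. Hence the distance to \<open>F\<close> cannot fall below
      \<open>\<epsilon>\<close> on the way.\<close>
    have ne: "sd (pt a b z) F - \<epsilon> \<noteq> 0" if z: "\<alpha> < z" "z < \<beta>" for z
    proof
      assume eq: "sd (pt a b z) F - \<epsilon> = 0"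
      have pz: "pt a b z = Ed a b z" using z \<alpha> \<beta> by (simp add: pt_open)
      have "Ed a b z \<in> cand f \<epsilon>"
        using eq inP[OF z] notF[of "Ed a b z"] unfolding pz by (simp add: cand_def)
      then show False using gap[OF z] by simp
    qed
    have "0 \<le> sd (pt a b x) F - \<epsilon>"
    proof (rule sign_persists[OF _ \<alpha>(2) \<beta>(2) ne _ x])
      show "continuous_on {\<alpha>..\<beta>} (\<lambda>x. sd (pt a b x) F - \<epsilon>)"
        by (intro continuous_intros sd_pt_continuous ab \<alpha> \<beta>)
      show "0 < sd (pt a b x0) F - \<epsilon>"
        using ne[OF \<alpha>(2) \<beta>(2)] bspec[OF far p(1)] px x0 by (simp add: pt_open)
    qed
    then show ?thesis by simp
  qed
  have noF: "Ed a b x \<notin> F" if x: "\<alpha> < x" "x < \<beta>" for x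
    using notF eps[of x] x \<alpha> \<beta> by (simp add: pt_open)
  interpret edge_move V E wl F S a b \<alpha> \<beta> x0
  proof
    show "pd (Vx v) (Ed a b x) \<noteq> sd (Vx v) F" if v: "v \<in> V" and x: "\<alpha> < x" "x < \<beta>" for v x
    proof
      assume "pd (Vx v) (Ed a b x) = sd (Vx v) F"
      \<comment> \<open>\<Gamma>(v) omits \<open>f v\<close>, but this is a facility and so does not
        occur in the gap.\<close>
      moreover have "Ed a b x \<noteq> f v" using noF[OF x] f v by metis
      ultimately have "Ed a b x \<in> cand f \<epsilon>"
        using v inP[OF x] noF[OF x] unfolding cand_def by blast
      then show False using gap[OF x] by simp
    qed
  qed (use S p px ab \<alpha> \<beta> noF in auto)
  obtain x where x: "x \<in> {\<alpha>, \<beta>}" "Q2 V E wv wl F S \<le> Q2 V E wv wl F (mv x ` S)"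
    using Q2_endpoint[OF wv] by blast
  have "x \<in> Z" "x \<in> {\<alpha>..\<beta>}" using x \<alpha> \<beta> by auto
  moreover have "mv x ` S = insert (pt a b x) (S - {p})"
    using p by (auto simp: mv_def px)
  \<comment> \<open>A stopping place inside the edge is a candidate by the choice of
    \<open>Z\<close>; otherwise it is a vertex, and its distance from \<open>F\<close> keeps it
    among the candidates.\<close>
  moreover have "pt a b x \<in> cand f \<epsilon>" if "sd (pt a b x) F \<ge> \<epsilon>"
  proof (cases "0 < x \<and> x < wl (a, b)")
    case True
    then show ?thesis using \<open>x \<in> Z\<close> by (auto simp: Z_def pt_open)
  next
    case False
    then have "pt a b x \<in> Vx ` V" using edgeD[OF ab] by (auto simp: pt_def)
    then show ?thesis using notF[OF that] by (simp add: cand_def)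
  qed
  ultimately show ?thesis using eps x(2) by metis
qed

text \<open>Each move lowers the number of points that are not candidates. The size of the placement
  drops when \<open>q\<close> already belongs to it, hence
  \<open>card T \<le> card S\<close>.\<close>

lemma reduce_to_cand:
  assumes wv: "\<forall>v\<in>V. wv v \<ge> 0" and f: "\<forall>v\<in>V. f v \<in> F" and \<epsilon>: "\<epsilon> > 0"
    and S: "finite S" "S \<subseteq> P" and far: "\<forall>p\<in>S. sd p F \<ge> \<epsilon>"
  shows "\<exists>T\<subseteq>cand f \<epsilon>. card T \<le> card S \<and> Q2 V E wv wl F S \<le> Q2 V E wv wl F T"
  using S far
proof (induction "card (S - cand f \<epsilon>)" arbitrary: S rule: less_induct)
  case less
  show ?case
  proof (cases "S \<subseteq> cand f \<epsilon>")
    case True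
    then show ?thesis by blast
  next
    case False
    then obtain p where p: "p \<in> S" "p \<notin> cand f \<epsilon>" by blast
    obtain q where q: "q \<in> cand f \<epsilon>" "sd q F \<ge> \<epsilon>"
      "Q2 V E wv wl F S \<le> Q2 V E wv wl F (insert q (S - {p}))"
      using move_to_cand[OF wv f \<epsilon> less.prems(1,2) less.prems(3) p] by blast
    let ?S = "insert q (S - {p})"
    have lt: "card (?S - cand f \<epsilon>) < card (S - cand f \<epsilon>)"
      using p q(1) less.prems(1) by (intro psubset_card_mono) auto
    have "finite ?S" "?S \<subseteq> P" "\<forall>r\<in>?S. sd r F \<ge> \<epsilon>"
      using less.prems q(1,2) cand_subset(1)[of f \<epsilon>] by auto
    from less.hyps[OF lt this] obtain T where
      T: "T \<subseteq> cand f \<epsilon>" "card T \<le> card ?S" "Q2 V E wv wl F ?S \<le> Q2 V E wv wl F T" by blast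
    have "card ?S \<le> Suc (card (S - {p}))" using less.prems(1) by (simp add: card_insert_if)
    also have "\<dots> = card S" using card_Suc_Diff1[OF less.prems(1) p(1)] .
    finally have "card ?S \<le> card S" .
    then show ?thesis using T q(3) by (meson order_trans)
  qed
qed

section \<open>From candidate placements to the supremum\<close>

lemma infinite_P: "E \<noteq> {} \<Longrightarrow> infinite P"
proof -
  assume "E \<noteq> {}"
  then obtain a b where ab: "(a, b) \<in> E" by auto
  then have "infinite {0<..<wl (a, b)}" using edgeD[OF ab] by simp
  moreover have "inj_on (Ed a b) {0<..<wl (a, b)}" by (simp add: inj_on_def)
  ultimately have "infinite (Ed a b ` {0<..<wl (a, b)})" by (simp add: finite_image_iff)
  moreover have "Ed a b ` {0<..<wl (a, b)} \<subseteq> P" using ab by auto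
  ultimately show ?thesis using finite_subset by blast
qed

text \<open>An edge has infinitely many points, so there is always room outside \<open>F\<close> to
  pad to exactly \<open>k\<close>; together with \<open>Q2_mono\<close> this compares placements of
  at most \<open>k\<close> points with \<open>eta\<close>.\<close>

lemma extend_placement:
  assumes "E \<noteq> {}" "finite T" "T \<subseteq> P" "T \<inter> F = {}" "card T \<le> k"
  shows "\<exists>S. T \<subseteq> S \<and> S \<subseteq> P \<and> finite S \<and> card S = k \<and> S \<inter> F = {}"
proof -
  have "infinite (P - F - T)" using infinite_P[OF assms(1)] finF assms(2) by simp
  from infinite_arbitrarily_large[OF this, of "k - card T"]
  obtain U where U: "U \<subseteq> P - F - T" "finite U" "card U = k - card T" by blast
  have "card (T \<union> U) = k" using U assms by (subst card_Un_disjoint) auto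
  then show ?thesis using U assms by (intro exI[of _ "T \<union> U"]) auto
qed

lemma eta_eq_SUP_cand:
  assumes Ene: "E \<noteq> {}" and wv: "\<forall>v\<in>V. wv v \<ge> 0" and f: "\<forall>v\<in>V. f v \<in> F"
  shows "eta V E wv wl k F =
    (SUP \<epsilon>\<in>{0<..}. Max {Q2 V E wv wl F S | S. S \<subseteq> cand f \<epsilon> \<and> finite S \<and> card S \<le> k})"
proof -
  let ?Q = "Q2 V E wv wl F"
  define A where "A = {?Q S | S. S \<subseteq> P \<and> finite S \<and> card S = k \<and> S \<inter> F = {}}"
  define M where "M \<epsilon> = {?Q S | S. S \<subseteq> cand f \<epsilon> \<and> finite S \<and> card S \<le> k}" for \<epsilon>
  have bddA: "bdd_above A"
    by (rule bdd_aboveI[of _ "sum wv V + sum wl E"]) (use Q2_bound wv in \<open>auto simp: A_def\<close>)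
  have neA: "A \<noteq> {}" using extend_placement[OF Ene, of "{}" k] by (auto simp: A_def)
  have finM: "finite (M \<epsilon>)" for \<epsilon>
    by (rule finite_subset[of _ "?Q ` Pow (cand f \<epsilon>)"]) (auto simp: M_def finite_cand)
  \<comment> \<open>The empty placement is admissible for every \<open>\<epsilon>\<close>.\<close>
  have neM: "M \<epsilon> \<noteq> {}" for \<epsilon>
  proof -
    have "?Q {} \<in> M \<epsilon>" unfolding M_def by force
    then show ?thesis by blast
  qed
  have M_le: "Max (M \<epsilon>) \<le> Sup A" for \<epsilon>
  proof -
    obtain T where T: "Max (M \<epsilon>) = ?Q T" "T \<subseteq> cand f \<epsilon>" "finite T" "card T \<le> k"
      using Max_in[OF finM neM, of \<epsilon>] unfolding M_def by blast
    then have "T \<subseteq> P" "T \<inter> F = {}" using cand_subset[of f \<epsilon>] by blast+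
    from extend_placement[OF Ene T(3) this T(4)] obtain S where
      S: "T \<subseteq> S" "S \<subseteq> P" "finite S" "card S = k" "S \<inter> F = {}" by blast
    have "?Q T \<le> ?Q S" using Q2_mono S wv by blast
    also have "\<dots> \<le> Sup A" using S by (intro cSup_upper bddA) (auto simp: A_def)
    finally show ?thesis using T by simp
  qed
  have bddM: "bdd_above ((\<lambda>\<epsilon>. Max (M \<epsilon>)) ` {0<..})"
    by (rule bdd_aboveI[of _ "Sup A"]) (use M_le in auto)
  have "Sup A = (SUP \<epsilon>\<in>{0<..}. Max (M \<epsilon>))"
  proof (rule antisym)
    show "Sup A \<le> (SUP \<epsilon>\<in>{0<..}. Max (M \<epsilon>))"
    proof (rule cSup_least[OF neA])
      fix r assume "r \<in> A"
      then obtain S where S: "r = ?Q S" "S \<subseteq> P" "finite S" "card S = k" "S \<inter> F = {}"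
        by (auto simp: A_def)
      \<comment> \<open>The distance from \<open>S\<close> to \<open>F\<close>, capped at 1, is
        positive since \<open>S\<close> is finite and disjoint from \<open>F\<close>; the 1 also
        covers empty \<open>S\<close>, that is \<open>k = 0\<close>.\<close>
      define \<epsilon> where "\<epsilon> = Min (insert 1 ((\<lambda>p. sd p F) ` S))"
      have fin: "finite (insert 1 ((\<lambda>p. sd p F) ` S))" using S(3) by simp
      have "sd p F > 0" if "p \<in> S" for p using sd_pos that S(2,5) by blast
      then have "\<epsilon> > 0" unfolding \<epsilon>_def by (subst Min_gr_iff[OF fin]) auto
      have far: "\<forall>p\<in>S. sd p F \<ge> \<epsilon>"
        unfolding \<epsilon>_def by (intro ballI Min_le[OF fin]) simp
      from reduce_to_cand[OF wv f \<open>\<epsilon> > 0\<close> S(3,2) far]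
      obtain T where T: "T \<subseteq> cand f \<epsilon>" "card T \<le> card S" "?Q S \<le> ?Q T"
        by blast
      have "finite T" using T(1) finite_cand by (rule finite_subset)
      then have "?Q T \<in> M \<epsilon>" using T S by (auto simp: M_def)
      then have "?Q T \<le> Max (M \<epsilon>)" using finM by simp
      also have "\<dots> \<le> (SUP \<epsilon>\<in>{0<..}. Max (M \<epsilon>))"
        using \<open>\<epsilon> > 0\<close> by (intro cSUP_upper bddM) simp
      finally show "r \<le> (SUP \<epsilon>\<in>{0<..}. Max (M \<epsilon>))" using T S by simp
    qed
    show "(SUP \<epsilon>\<in>{0<..}. Max (M \<epsilon>)) \<le> Sup A"
      by (rule cSUP_least) (use M_le in auto)
  qed
  then show ?thesis unfolding eta_def A_def M_def .
qed

end

theorem theorem2: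
  fixes V :: "'v::linorder set" and E :: "('v \<times> 'v) set"
    and wv :: "'v \<Rightarrow> real" and wl :: "'v \<times> 'v \<Rightarrow> real"
    and F :: "'v point set" and k :: nat and f :: "'v \<Rightarrow> 'v point"
  assumes finV: "finite V"
    and EV: "E \<subseteq> V \<times> V"
    and Eord: "\<forall>(a, b)\<in>E. a < b"
    and Ene: "E \<noteq> {}"
    and wl_pos: "\<forall>e\<in>E. wl e > 0"
    and wv_nonneg: "\<forall>v\<in>V. wv v \<ge> 0"
    and conn: "\<forall>u\<in>V. \<forall>v\<in>V. \<exists>xs. is_walk E u v xs"
    and F_pts: "F \<subseteq> Pts V E wl" and finF: "finite F" and Fne: "card F \<ge> 1"
    and f_in: "\<forall>v\<in>V. f v \<in> F"
    and f_near: "\<forall>v\<in>V. pdist E wl (Vx v) (f v) = dist_to_set E wl (Vx v) F"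
  shows
    "let Gamma = (\<lambda>v. {p \<in> Pts V E wl. p \<noteq> f v \<and> pdist E wl (Vx v) p = dist_to_set E wl (Vx v) F});
         Gamma0 = (\<Union>v\<in>V. Gamma v);
         N = (\<lambda>\<epsilon>. {p \<in> Pts V E wl. dist_to_set E wl p F = \<epsilon>});
         C = (\<lambda>\<epsilon>. (Gamma0 \<union> Vx ` V \<union> N \<epsilon>) - F)
     in eta V E wv wl k F =
        (SUP \<epsilon>\<in>{0<..}. Max {Q2 V E wv wl F S | S. S \<subseteq> C \<epsilon> \<and> finite S \<and> card S \<le> k})"
proof -
  interpret facilities V E wl F
    by unfold_locales (use finV EV Eord wl_pos conn F_pts finF Fne in auto)
  show ?thesis
    using eta_eq_SUP_cand[OF Ene wv_nonneg, of f k] f_in unfolding cand_def Let_def by blast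
qed

end
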